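(* There exists a constant $c>0$ such that the following holds. Let $\Omega \subset \mathbb{R}^2$ be an open set that has finite measure and is simply connected, and let $u \in C^2(\Omega)\cap C(\overline{\Omega})$. Then $$ \max_{x \in \Omega} |u(x)| \leq \max_{x \in \partial \Omega}|u(x)| + c \max_{x \in \Omega} \int_{y \in \Omega} \max\left\{ 1, \log\left(\frac{\operatorname{inrad}(\Omega)^2}{\|x-y\|^2}\right) \right\} \left| \Delta u(y)\right| dy .$$
   Context: $\operatorname{inrad}(\Omega)$ denotes the inradius of $\Omega$, i.e. the supremum of the radii of open disks contained in $\Omega$. $\|\cdot\|$ is the Euclidean norm on $\mathbb{R}^2$, $\Delta = \partial_1^2+\partial_2^2$ is the Laplacian, and $dy$ is Lebesgue measure. The constant $c$ does not depend on $\Omega$ or on $u$.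
   Formalization: The maxima are read as suprema, and u is additionally assumed bounded on Ω (automatic when Ω is bounded); for unbounded Ω of finite measure, such as a cusp, an unbounded harmonic u with zero boundary values violates the inequality. *)

theory Defs
  imports "HOL-Analysis.Analysis"
begin

definition partial_deriv :: "'n::finite \<Rightarrow> (real ^ 'n \<Rightarrow> real) \<Rightarrow> real ^ 'n \<Rightarrow> real" where
  "partial_deriv i f x = deriv (\<lambda>t. f (x + t *\<^sub>R axis i 1)) 0"

text \<open>Intended for open sets only: the difference quotients at a point of \<open>S\<close> then involve only
  values of \<open>f\<close> on \<open>S\<close>, so the (arbitrary) values of \<open>f\<close> outside \<open>S\<close> play no role.\<close>

fun Ck_on :: "nat \<Rightarrow> (real ^ 'n::finite) set \<Rightarrow> (real ^ 'n \<Rightarrow> real) \<Rightarrow> bool" where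
  "Ck_on 0 S f \<longleftrightarrow> continuous_on S f"
| "Ck_on (Suc k) S f \<longleftrightarrow> continuous_on S f \<and>
     (\<forall>i. (\<forall>x\<in>S. (\<lambda>t. f (x + t *\<^sub>R axis i 1)) differentiable (at 0)) \<and>
          Ck_on k S (partial_deriv i f))"

definition laplacian :: "(real ^ 'n::finite \<Rightarrow> real) \<Rightarrow> real ^ 'n \<Rightarrow> real" where
  "laplacian f x = (\<Sum>i\<in>UNIV. partial_deriv i (partial_deriv i f) x)"

text \<open>Real-valued, hence meaningful only if the radii are bounded above; this is the case for
  nonempty open sets of finite measure.\<close>

definition inradius :: "'a::metric_space set \<Rightarrow> real" where
  "inradius S = Sup {r. 0 < r \<and> (\<exists>x. ball x r \<subseteq> S)}"

end

theory Submission
  imports Defs "HOL-Complex_Analysis.Riemann_Mapping"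
begin

text \<open>
  Let \<open>r\<close> be the inradius, fix \<open>x\<close> in the domain and transport everything to the unit disc by a
  Riemann map \<open>\<phi>\<close> with \<open>\<phi> 0 = x\<close>. The Green function of the domain with pole \<open>x\<close> is then
  \<open>- ln \<bar>w\<bar> / (2 \<pi>)\<close> at the point \<open>\<phi> w\<close>, so Jensen's formula bounds \<open>\<bar>u x\<bar>\<close> by the mean of \<open>\<bar>u\<bar>\<close>
  over the image of a circle close to the unit circle, plus the integral of the Green function
  against \<open>\<bar>\<Delta> u\<bar>\<close>. The estimate follows because the Green function is bounded pointwise by a
  multiple of the kernel \<open>max 1 (ln (r\<^sup>2 / \<bar>x - y\<bar>\<^sup>2))\<close> (\<open>green_function_le_kernel\<close>). By Bloch's theorem
  the image of the disc contains a disc of radius \<open>\<bar>\<phi>' w\<bar> / 24\<close> whenever \<open>\<bar>w\<bar> \<le> 1 / 2\<close>, so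
  \<open>\<bar>\<phi>'\<bar> \<le> 24 r\<close> there and \<open>\<bar>\<phi> w - x\<bar> \<le> 24 r \<bar>w\<bar>\<close>; taking logarithms gives the bound for small \<open>w\<close>,
  and for \<open>\<bar>w\<bar> \<ge> 1 / 2\<close> the Green function is bounded anyway.

  Jensen's formula is proved in logarithmic coordinates. With \<open>\<Psi> s = \<phi> (exp s)\<close> on the left half
  plane, \<open>u \<circ> \<Psi>\<close> is \<open>2 \<pi> \<i>\<close>-periodic and its Laplacian is \<open>\<Delta> u (\<Psi> s) \<bar>\<Psi>' s\<bar>\<^sup>2\<close>. Integrating over one vertical
  period kills the second derivative in the periodic direction (\<open>circle_int_dir_deriv2\<close>), so the
  integral \<open>m t\<close> of \<open>u \<circ> \<Psi>\<close> over the period at abscissa \<open>t\<close> has \<open>m''\<close> equal to the integral of that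
  Laplacian. Since \<open>m\<close> tends to \<open>2 \<pi> u x\<close> at \<open>- \<infinity>\<close>, Taylor's formula compares \<open>m T\<close> with
  \<open>2 \<pi> u x\<close>, with an error that is a double integral weighted by at most \<open>- t = - ln \<bar>w\<bar>\<close>
  (\<open>taylor_at_bot_bound\<close>). The map \<open>\<Psi>\<close> is injective on a strip of height \<open>2 \<pi>\<close> with Jacobian
  \<open>\<bar>\<Psi>'\<bar>\<^sup>2\<close>, which turns the double integral into an integral over the domain (\<open>strip_integral_le\<close>).

  It remains to see that \<open>m T\<close> is asymptotically at most \<open>2 \<pi>\<close> times the supremum of \<open>\<bar>u\<bar>\<close> on the
  boundary (\<open>circle_int_near_boundary\<close>). If the domain is unbounded, a circle near the unit
  circle can still have points that \<open>\<phi>\<close> sends far away, where \<open>u\<close> need not be close to its boundary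
  values. There are few of them: a square root of \<open>\<phi> - z\<close>, with \<open>z\<close> outside the domain, omits
  a disc, so that the logarithm of its distance to the centre of that disc is a harmonic function
  that is bounded below, has a fixed mean, and is large wherever \<open>\<phi>\<close> is large
  (\<open>injective_holomorphic_majorant\<close>).
\<close>

section \<open>The plane as complex numbers and as vectors\<close>

definition plane :: "complex \<Rightarrow> real ^ 2" where
  "plane z = (\<chi> i. if i = 1 then Re z else Im z)"

lemma plane_nth [simp]: "plane z $ 1 = Re z" "plane z $ 2 = Im z"
  by (simp_all add: plane_def)

lemma plane_Complex [simp]: "plane (Complex (v $ 1) (v $ 2)) = v"
  by (simp add: vec_eq_iff forall_2)

lemma linear_plane: "linear plane"
  by (rule linearI) (simp_all add: vec_eq_iff forall_2)

lemma norm_plane [simp]: "norm (plane z) = norm z"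
  by (simp add: norm_vec_def L2_set_def UNIV_2 cmod_def)

lemma plane_diff: "plane (z - w) = plane z - plane w"
  by (rule linear_diff [OF linear_plane])

lemma dist_plane [simp]: "dist (plane z) (plane w) = dist z w"
  by (metis dist_norm norm_plane plane_diff)

lemma plane_inject [simp]: "plane z = plane w \<longleftrightarrow> z = w"
  using dist_plane[of z w] by (metis dist_eq_0_iff)

lemma bounded_linear_plane: "bounded_linear plane"
  using linear_plane linear_conv_bounded_linear by blast

lemma continuous_on_plane [continuous_intros]:
  "continuous_on S f \<Longrightarrow> continuous_on S (\<lambda>x. plane (f x))"
  using bounded_linear.continuous_on [OF bounded_linear_plane] by blast

lemma open_plane_vimage: "open S \<Longrightarrow> open {z. plane z \<in> S}"
  using open_vimage[of S plane] continuous_on_plane[OF continuous_on_id, of UNIV]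
  by (simp add: vimage_def)

lemma homeomorphic_plane: "{z. plane z \<in> S} homeomorphic S"
proof -
  have "homeomorphism {z. plane z \<in> S} S plane (\<lambda>v. Complex (v $ 1) (v $ 2))"
  proof (rule homeomorphismI)
    show "continuous_on S (\<lambda>v. Complex (v $ 1) (v $ 2))"
      unfolding Complex_eq by (intro continuous_intros)
  qed (auto intro: continuous_intros)
  then show ?thesis
    unfolding homeomorphic_def by blast
qed

lemma open_plane_image:
  assumes "open U"
  shows "open (plane ` U)"
proof -
  have "plane ` U = (\<lambda>v. Complex (v $ 1) (v $ 2)) -` U"
    by (auto simp: image_iff) (metis plane_Complex)
  moreover have "continuous_on UNIV (\<lambda>v::real^2. Complex (v $ 1) (v $ 2))"
    unfolding Complex_eq by (intro continuous_intros)
  ultimately show ?thesis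
    using open_vimage[OF assms] by metis
qed

section \<open>Derivatives of a function pulled back by a holomorphic map\<close>

text \<open>Continuous partial derivatives imply total differentiability. The function is viewed as one of two
  real variables on a product neighbourhood that is convex in the second variable.\<close>

lemma has_derivative_Ck1:
  fixes f :: "real ^ 2 \<Rightarrow> real"
  assumes f: "Ck_on (Suc 0) S f" and S: "open S" and x: "x \<in> S"
  shows "(f has_derivative
           (\<lambda>h. partial_deriv 1 f x * h $ 1 + partial_deriv 2 f x * h $ 2)) (at x)"
proof -
  define P where "P = (\<lambda>a b. plane (Complex a b))"
  have Px: "P (x $ 1) (x $ 2) = x" by (simp add: P_def)
  have line: "((\<lambda>t. f (y + t *\<^sub>R axis i 1)) has_real_derivative partial_deriv i f y) (at 0)"
    if "y \<in> S" for y i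
    using f that unfolding partial_deriv_def
    by (metis Ck_on.simps(2) DERIV_deriv_iff_real_differentiable)
  have contP: "continuous_on UNIV (\<lambda>(a, b). P a b)"
    unfolding P_def split_beta Complex_eq by (intro continuous_intros)
  have "open ((\<lambda>(a, b). P a b) -` S)"
    by (rule open_vimage[OF S contP])
  moreover have "(x $ 1, x $ 2) \<in> (\<lambda>(a, b). P a b) -` S"
    using x Px by simp
  ultimately obtain A B where AB: "open A" "open B" "x $ 1 \<in> A" "x $ 2 \<in> B"
      "A \<times> B \<subseteq> (\<lambda>(a, b). P a b) -` S"
    using open_prod_elim by (metis mem_Sigma_iff)
  obtain e where e: "e > 0" "ball (x $ 2) e \<subseteq> B"
    using AB openE by blast
  define Y where "Y = ball (x $ 2) e"
  have inS: "P a b \<in> S" if "a \<in> A" "b \<in> Y" for a b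
    using AB(5) e that unfolding Y_def by (auto simp: subset_iff)
  have d1: "((\<lambda>a. f (P a (x $ 2))) has_derivative (*) (partial_deriv 1 f x)) (at (x $ 1) within A)"
  proof -
    have eq: "(\<lambda>a. f (P a (x $ 2))) = (\<lambda>a. f (x + (a - x $ 1) *\<^sub>R axis 1 1))"
      by (intro ext arg_cong[of _ _ f]) (simp add: P_def vec_eq_iff forall_2 axis_def)
    have "((\<lambda>a. f (x + (a - x $ 1) *\<^sub>R axis 1 1)) has_real_derivative
        partial_deriv 1 f x) (at (0 + x $ 1))"
      by (subst DERIV_shift) (simp add: line x)
    then show ?thesis
      unfolding eq by (auto simp: has_field_derivative_def intro: has_derivative_at_withinI)
  qed
  have d2: "((\<lambda>b. f (P a b)) has_derivative blinfun_apply (blinfun_mult_right (partial_deriv 2 f (P a b))))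
      (at b within Y)" if "a \<in> A" "b \<in> Y" for a b
  proof -
    have eq: "(\<lambda>b. f (P a b)) = (\<lambda>c. f (P a b + (c - b) *\<^sub>R axis 2 1))"
      by (intro ext arg_cong[of _ _ f]) (simp add: P_def vec_eq_iff forall_2 axis_def)
    have "((\<lambda>c. f (P a b + (c - b) *\<^sub>R axis 2 1)) has_real_derivative
        partial_deriv 2 f (P a b)) (at (0 + b))"
      by (subst DERIV_shift) (simp add: line inS that)
    then show ?thesis
      unfolding eq by (auto simp: has_field_derivative_def intro: has_derivative_at_withinI)
  qed
  have "continuous_on (A \<times> Y) (\<lambda>(a, b). blinfun_mult_right (partial_deriv 2 f (P a b)))"
  proof -
    have "continuous_on S (partial_deriv 2 f)"
      using f by (metis Ck_on.simps)
    then have "continuous_on (A \<times> Y) (\<lambda>p. partial_deriv 2 f (case p of (a, b) \<Rightarrow> P a b))"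
      by (rule continuous_on_compose2) (use inS in \<open>auto intro: continuous_on_subset[OF contP]\<close>)
    then show ?thesis
      unfolding split_beta by (intro continuous_intros)
  qed
  then have d3: "continuous (at (x $ 1, x $ 2) within A \<times> Y)
      (\<lambda>(a, b). blinfun_mult_right (partial_deriv 2 f (P a b)))"
    using AB e by (auto simp: continuous_on_eq_continuous_within Y_def)
  have "((\<lambda>(a, b). f (P a b)) has_derivative
      (\<lambda>(s, t). partial_deriv 1 f x * s + blinfun_mult_right (partial_deriv 2 f (P (x$1) (x$2))) t))
      (at (x $ 1, x $ 2) within A \<times> Y)"
    by (rule has_derivative_partialsI[OF d1 d2 d3]) (use e in \<open>auto simp: Y_def\<close>)
  then have D: "((\<lambda>(a, b). f (P a b)) has_derivative
      (\<lambda>(s, t). partial_deriv 1 f x * s + partial_deriv 2 f x * t)) (at (x $ 1, x $ 2))"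
    using AB e by (subst (asm) at_within_open) (auto simp: Y_def open_Times Px)
  have "((\<lambda>v::real^2. (v $ 1, v $ 2)) has_derivative (\<lambda>h. (h $ 1, h $ 2))) (at x)"
    by (intro has_derivative_Pair bounded_linear_imp_has_derivative bounded_linear_vec_nth)
  from has_derivative_compose[OF this D] show ?thesis
    by (simp add: P_def)
qed

lemma DERIV_along_curve:
  fixes f :: "real ^ 2 \<Rightarrow> real"
  assumes "Ck_on (Suc 0) S f" "open S" "plane (\<gamma> t) \<in> S"
    and \<gamma>: "(\<gamma> has_vector_derivative v) (at t)"
  shows "((\<lambda>t. f (plane (\<gamma> t))) has_real_derivative
           partial_deriv 1 f (plane (\<gamma> t)) * Re v + partial_deriv 2 f (plane (\<gamma> t)) * Im v) (at t)"
proof -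
  have "((\<lambda>t. plane (\<gamma> t)) has_derivative (\<lambda>h. plane (h *\<^sub>R v))) (at t)"
    using bounded_linear.has_derivative[OF bounded_linear_plane \<gamma>[unfolded has_vector_derivative_def]] .
  from has_derivative_compose[OF this has_derivative_Ck1[OF assms(1-3)]]
  show ?thesis
    unfolding has_field_derivative_def
    by (rule has_derivative_eq_rhs) (simp add: fun_eq_iff algebra_simps)
qed

text \<open>The derivatives of \<open>f \<circ> plane \<circ> \<Psi>\<close> along a constant direction \<open>d\<close>, of first and second order, as the
  chain rule gives them.\<close>

definition dir_deriv :: "(real ^ 2 \<Rightarrow> real) \<Rightarrow> (complex \<Rightarrow> complex) \<Rightarrow> complex \<Rightarrow> complex \<Rightarrow> real" where
  "dir_deriv f \<Psi> d s =
     partial_deriv 1 f (plane (\<Psi> s)) * Re (deriv \<Psi> s * d) +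
     partial_deriv 2 f (plane (\<Psi> s)) * Im (deriv \<Psi> s * d)"

definition dir_deriv2 :: "(real ^ 2 \<Rightarrow> real) \<Rightarrow> (complex \<Rightarrow> complex) \<Rightarrow> complex \<Rightarrow> complex \<Rightarrow> real" where
  "dir_deriv2 f \<Psi> d s =
     dir_deriv (partial_deriv 1 f) \<Psi> d s * Re (deriv \<Psi> s * d) +
     dir_deriv (partial_deriv 2 f) \<Psi> d s * Im (deriv \<Psi> s * d) +
     partial_deriv 1 f (plane (\<Psi> s)) * Re (deriv (deriv \<Psi>) s * d\<^sup>2) +
     partial_deriv 2 f (plane (\<Psi> s)) * Im (deriv (deriv \<Psi>) s * d\<^sup>2)"

text \<open>Conformality: for the directions \<open>1\<close> and \<open>\<i>\<close> the terms with \<open>\<Psi>''\<close> cancel because \<open>\<i>\<^sup>2 = - 1\<close>, and the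
  mixed terms of the first direction cancel those of the second.\<close>

lemma dir_deriv2_sum:
  "dir_deriv2 f \<Psi> 1 s + dir_deriv2 f \<Psi> \<i> s = laplacian f (plane (\<Psi> s)) * (cmod (deriv \<Psi> s))\<^sup>2"
  unfolding cmod_power2
  by (simp add: dir_deriv2_def dir_deriv_def laplacian_def sum_2 power2_eq_square algebra_simps)

lemma
  fixes f :: "real ^ 2 \<Rightarrow> real"
  assumes f: "Ck_on 2 S f" and S: "open S" and W: "open W" and hol: "\<Psi> holomorphic_on W"
    and into: "\<And>s. s \<in> W \<Longrightarrow> plane (\<Psi> s) \<in> S"
    and \<sigma>: "(\<sigma> has_vector_derivative d) (at t)" "\<sigma> t \<in> W"
  shows DERIV_pullback: "((\<lambda>t. f (plane (\<Psi> (\<sigma> t)))) has_real_derivative dir_deriv f \<Psi> d (\<sigma> t)) (at t)"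
    and DERIV_dir_deriv2: "((\<lambda>t. dir_deriv f \<Psi> d (\<sigma> t)) has_real_derivative dir_deriv2 f \<Psi> d (\<sigma> t)) (at t)"
proof -
  have Ck: "Ck_on (Suc 0) S f" "Ck_on (Suc 0) S (partial_deriv i f)" for i
    using f by (auto simp: numeral_2_eq_2)
  have c: "((\<lambda>t. \<Psi> (\<sigma> t)) has_vector_derivative deriv \<Psi> (\<sigma> t) * d) (at t)"
    using field_vector_diff_chain_at[OF \<sigma>(1), of \<Psi> "deriv \<Psi> (\<sigma> t)"] hol \<sigma>(2) W
    by (auto simp: o_def mult.commute intro: holomorphic_derivI)
  have c': "((\<lambda>t. deriv \<Psi> (\<sigma> t)) has_vector_derivative deriv (deriv \<Psi>) (\<sigma> t) * d) (at t)"
    using field_vector_diff_chain_at[OF \<sigma>(1), of "deriv \<Psi>" "deriv (deriv \<Psi>) (\<sigma> t)"] hol \<sigma>(2) W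
    by (auto simp: o_def mult.commute intro: holomorphic_derivI holomorphic_deriv)
  show "((\<lambda>t. f (plane (\<Psi> (\<sigma> t)))) has_real_derivative dir_deriv f \<Psi> d (\<sigma> t)) (at t)"
    unfolding dir_deriv_def by (rule DERIV_along_curve[OF Ck(1) S into[OF \<sigma>(2)] c])
  have p: "((\<lambda>t. partial_deriv i f (plane (\<Psi> (\<sigma> t)))) has_real_derivative
      dir_deriv (partial_deriv i f) \<Psi> d (\<sigma> t)) (at t)" for i
    unfolding dir_deriv_def by (rule DERIV_along_curve[OF Ck(2) S into[OF \<sigma>(2)] c])
  have c'': "((\<lambda>t. deriv \<Psi> (\<sigma> t) * d) has_vector_derivative deriv (deriv \<Psi>) (\<sigma> t) * d\<^sup>2) (at t)"
    using has_vector_derivative_mult_left[OF c', of d] by (simp add: power2_eq_square mult.assoc)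
  have re: "((\<lambda>t. Re (deriv \<Psi> (\<sigma> t) * d)) has_real_derivative
      Re (deriv (deriv \<Psi>) (\<sigma> t) * d\<^sup>2)) (at t)"
    and im: "((\<lambda>t. Im (deriv \<Psi> (\<sigma> t) * d)) has_real_derivative
      Im (deriv (deriv \<Psi>) (\<sigma> t) * d\<^sup>2)) (at t)"
    using bounded_linear.has_vector_derivative[OF bounded_linear_Re c'']
      bounded_linear.has_vector_derivative[OF bounded_linear_Im c'']
    by (simp_all add: has_real_derivative_iff_has_vector_derivative)
  show "((\<lambda>t. dir_deriv f \<Psi> d (\<sigma> t)) has_real_derivative dir_deriv2 f \<Psi> d (\<sigma> t)) (at t)"
    unfolding dir_deriv_def[of f]
    by (rule derivative_eq_intros p re im refl)+ (simp add: dir_deriv2_def algebra_simps)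
qed

lemma
  fixes f :: "real ^ 2 \<Rightarrow> real"
  assumes f: "Ck_on 2 S f" and W: "open W" and hol: "\<Psi> holomorphic_on W"
    and into: "\<And>s. s \<in> W \<Longrightarrow> plane (\<Psi> s) \<in> S"
  shows continuous_on_dir_deriv: "continuous_on W (dir_deriv f \<Psi> d)"
    and continuous_on_dir_deriv2: "continuous_on W (dir_deriv2 f \<Psi> d)"
proof -
  have c: "continuous_on S (partial_deriv i f)" "continuous_on S (partial_deriv j (partial_deriv i f))" for i j
    using f by (auto simp: numeral_2_eq_2)
  have \<Psi>: "continuous_on W \<Psi>" "continuous_on W (deriv \<Psi>)" "continuous_on W (deriv (deriv \<Psi>))"
    using hol W by (auto intro!: holomorphic_on_imp_continuous_on holomorphic_deriv)
  have p: "continuous_on W (\<lambda>s. partial_deriv i f (plane (\<Psi> s)))"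
    "continuous_on W (\<lambda>s. partial_deriv j (partial_deriv i f) (plane (\<Psi> s)))" for i j
    by (rule continuous_on_compose2[OF c(1)] continuous_on_compose2[OF c(2)];
        use into \<Psi> in \<open>auto intro: continuous_intros\<close>)+
  show "continuous_on W (dir_deriv f \<Psi> d)" "continuous_on W (dir_deriv2 f \<Psi> d)"
    unfolding dir_deriv_def[abs_def] dir_deriv2_def[abs_def] by (intro continuous_intros p \<Psi>)+
qed

lemma has_vector_derivative_Complex_Re: "((\<lambda>t. Complex t \<theta>) has_vector_derivative 1) (at t)"
  unfolding Complex_eq by (auto intro!: derivative_eq_intros)

lemma has_vector_derivative_Complex_Im: "((\<lambda>\<theta>. Complex t \<theta>) has_vector_derivative \<i>) (at \<theta>)"
  unfolding Complex_eq by (auto intro!: derivative_eq_intros)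

lemma deriv_periodic:
  assumes "\<And>s. \<Psi> (s + c) = \<Psi> s"
  shows "deriv \<Psi> (s + c) = deriv \<Psi> s"
proof -
  have "\<Psi> \<circ> (\<lambda>x. s + c + x) = \<Psi> \<circ> (\<lambda>x. s + x)"
    by (auto simp: fun_eq_iff) (metis add.commute add.left_commute assms)
  then show ?thesis
    using deriv_shift_0'[where f = \<Psi> and z = "s + c"] deriv_shift_0'[where f = \<Psi> and z = s] by simp
qed

section \<open>Integrals over circles in logarithmic coordinates\<close>

text \<open>The line \<open>Re s = t\<close> covers the circle of radius \<open>exp t\<close> once as \<open>\<theta>\<close> runs from \<open>0\<close> to \<open>2 * pi\<close>; for a
  function of \<open>exp s\<close> this is its unnormalised mean over that circle.\<close>

definition circle_int :: "(complex \<Rightarrow> real) \<Rightarrow> real \<Rightarrow> real" where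
  "circle_int h t = integral {0..2 * pi} (\<lambda>\<theta>. h (Complex t \<theta>))"

lemma continuous_on_vline:
  assumes "continuous_on {s. Re s < 0} h" "t < 0"
  shows "continuous_on A (\<lambda>\<theta>. h (Complex t \<theta>))"
  by (rule continuous_on_compose2[OF assms(1)])
    (use assms(2) in \<open>auto simp: Complex_eq intro!: continuous_intros\<close>)

lemma DERIV_circle_int:
  assumes h: "continuous_on {s. Re s < 0} h" and h': "continuous_on {s. Re s < 0} h'"
    and D: "\<And>t \<theta>. t < 0 \<Longrightarrow> ((\<lambda>t. h (Complex t \<theta>)) has_real_derivative h' (Complex t \<theta>)) (at t)"
    and t: "t < 0"
  shows "(circle_int h has_real_derivative circle_int h' t) (at t)"
proof -
  have "((\<lambda>t. integral (cbox 0 (2 * pi)) (\<lambda>\<theta>. h (Complex t \<theta>))) has_real_derivative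
      integral (cbox 0 (2 * pi)) (\<lambda>\<theta>. h' (Complex t \<theta>))) (at t within {..<0})"
  proof (rule leibniz_rule_field_derivative)
    show "continuous_on ({..<0} \<times> cbox 0 (2 * pi)) (\<lambda>(t, \<theta>). h' (Complex t \<theta>))"
      unfolding split_beta
      by (rule continuous_on_compose2[OF h']) (auto simp: Complex_eq intro!: continuous_intros)
    show "(\<lambda>\<theta>. h (Complex t \<theta>)) integrable_on cbox 0 (2 * pi)" if "t \<in> {..<0}" for t
      using that by (intro integrable_continuous continuous_on_vline[OF h]) auto
  qed (use t D in \<open>auto intro: has_field_derivative_at_within\<close>)
  then show ?thesis
    using t by (subst (asm) at_within_open) (auto simp: circle_int_def[abs_def])
qed

lemma continuous_on_circle_int:
  assumes h: "continuous_on {s. Re s < 0} h"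
  shows "continuous_on {..<0} (circle_int h)"
proof -
  have "continuous_on {..<0} (\<lambda>t. integral (cbox 0 (2 * pi)) (\<lambda>\<theta>. h (Complex t \<theta>)))"
    by (rule integral_continuous_on_param, unfold split_beta, rule continuous_on_compose2[OF h])
      (auto simp: Complex_eq intro!: continuous_intros)
  then show ?thesis
    by (simp add: circle_int_def[abs_def])
qed

text \<open>The second derivative in the direction \<open>\<i>\<close> integrates to zero over a period, so the second derivative
  in the direction \<open>1\<close> and the whole Laplacian have the same integral.\<close>

lemma circle_int_dir_deriv2:
  fixes f :: "real ^ 2 \<Rightarrow> real"
  assumes f: "Ck_on 2 S f" and S: "open S" and hol: "\<Psi> holomorphic_on {s. Re s < 0}"
    and into: "\<And>s. Re s < 0 \<Longrightarrow> plane (\<Psi> s) \<in> S"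
    and per: "\<And>s. \<Psi> (s + 2 * pi * \<i>) = \<Psi> s"
    and t: "t < 0"
  shows "circle_int (dir_deriv2 f \<Psi> 1) t =
         circle_int (\<lambda>s. laplacian f (plane (\<Psi> s)) * (cmod (deriv \<Psi> s))\<^sup>2) t"
proof -
  have W: "open {s. Re s < 0}" by (rule open_halfspace_Re_lt)
  have c: "continuous_on {s. Re s < 0} (dir_deriv2 f \<Psi> d)" for d
    by (rule continuous_on_dir_deriv2[OF f W hol]) (use into in auto)
  have "((\<lambda>\<theta>. dir_deriv2 f \<Psi> \<i> (Complex t \<theta>)) has_integral
      (dir_deriv f \<Psi> \<i> (Complex t (2 * pi)) - dir_deriv f \<Psi> \<i> (Complex t 0))) {0..2 * pi}"
  proof (rule fundamental_theorem_of_calculus)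
    show "((\<lambda>\<theta>. dir_deriv f \<Psi> \<i> (Complex t \<theta>)) has_vector_derivative dir_deriv2 f \<Psi> \<i> (Complex t \<theta>))
        (at \<theta> within {0..2 * pi})" for \<theta>
      using DERIV_dir_deriv2[OF f S W hol _ has_vector_derivative_Complex_Im[of t \<theta>]] into t
      by (auto simp: has_real_derivative_iff_has_vector_derivative
          intro: has_vector_derivative_at_within)
  qed auto
  moreover have "Complex t (2 * pi) = Complex t 0 + 2 * pi * \<i>"
    by (simp add: complex_eq_iff)
  then have "dir_deriv f \<Psi> \<i> (Complex t (2 * pi)) = dir_deriv f \<Psi> \<i> (Complex t 0)"
    unfolding dir_deriv_def using per[of "Complex t 0"] deriv_periodic[of \<Psi>, OF per, of "Complex t 0"]
    by simp
  ultimately have z: "circle_int (dir_deriv2 f \<Psi> \<i>) t = 0"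
    unfolding circle_int_def by (simp add: integral_unique)
  have "circle_int (dir_deriv2 f \<Psi> 1) t + circle_int (dir_deriv2 f \<Psi> \<i>) t =
      circle_int (\<lambda>s. dir_deriv2 f \<Psi> 1 s + dir_deriv2 f \<Psi> \<i> s) t"
    unfolding circle_int_def
    by (rule integral_add[symmetric])
      (intro integrable_continuous_real continuous_on_vline[OF c t])+
  then show ?thesis
    using z by (simp add: dir_deriv2_sum)
qed

lemma continuous_on_comp_exp:
  assumes "continuous_on (ball 0 1) U"
  shows "continuous_on {s. Re s < 0} (\<lambda>s. U (exp s))"
  by (rule continuous_on_compose2[OF assms]) (auto intro: continuous_intros)

lemma circle_int_bound:
  assumes q: "continuous_on {s. Re s < 0} q" and k: "continuous_on {s. Re s < 0} k" and t: "t < 0"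
    and le: "\<And>\<theta>. \<bar>q (Complex t \<theta>)\<bar> \<le> k (Complex t \<theta>)"
  shows "\<bar>circle_int q t\<bar> \<le> circle_int k t"
proof -
  have "norm (circle_int q t) \<le> circle_int k t"
    unfolding circle_int_def
    by (intro integral_norm_bound_integral integrable_continuous_real
        continuous_on_vline[OF q t] continuous_on_vline[OF k t]) (use le in auto)
  then show ?thesis by simp
qed

lemma circle_int_tendsto:
  assumes U: "continuous_on (ball 0 1) U"
  shows "((circle_int (\<lambda>s. U (exp s))) \<longlongrightarrow> 2 * pi * U 0) at_bot"
proof (rule tendstoI)
  fix e :: real assume e: "e > 0"
  define e' where "e' = e / (4 * pi)"
  have e': "e' > 0" using e by (simp add: e'_def)
  obtain d where d: "d > 0" "\<And>w. w \<in> ball 0 1 \<Longrightarrow> dist w 0 < d \<Longrightarrow> dist (U w) (U 0) < e'"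
    using U e' unfolding continuous_on_iff by (metis centre_in_ball zero_less_one)
  have "dist (circle_int (\<lambda>s. U (exp s)) t) (2 * pi * U 0) < e" if t: "t < 0" "exp t < d" for t
  proof -
    have c: "continuous_on {s. Re s < 0} (\<lambda>s. U (exp s))"
      by (rule continuous_on_comp_exp[OF U])
    have "circle_int (\<lambda>s. U (exp s) - U 0) t = circle_int (\<lambda>s. U (exp s)) t - 2 * pi * U 0"
      unfolding circle_int_def
      by (subst integral_diff) (auto intro!: integrable_continuous_real continuous_on_vline[OF c t(1)])
    moreover have "\<bar>circle_int (\<lambda>s. U (exp s) - U 0) t\<bar> \<le> circle_int (\<lambda>s. e') t"
    proof (rule circle_int_bound)
      show "\<bar>U (exp (Complex t \<theta>)) - U 0\<bar> \<le> e'" for \<theta>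
        using d(2)[of "exp (Complex t \<theta>)"] t by (auto simp: dist_real_def)
    qed (use t c in \<open>auto intro: continuous_intros\<close>)
    moreover have "circle_int (\<lambda>s. e') t = e / 2"
      by (simp add: circle_int_def e'_def)
    ultimately show ?thesis using e by (simp add: dist_real_def)
  qed
  moreover have "\<forall>\<^sub>F t in at_bot. t < 0 \<and> exp t < d"
  proof -
    have "exp t < d" if "t \<le> ln d - 1" for t
    proof -
      have "exp t < exp (ln d)" using that by (subst exp_less_cancel_iff) simp
      then show ?thesis using d(1) by simp
    qed
    then have "t < 0 \<and> exp t < d" if "t \<le> min (- 1) (ln d - 1)" for t using that by auto
    then show ?thesis unfolding eventually_at_bot_linorder by blast
  qed
  ultimately show "\<forall>\<^sub>F t in at_bot. dist (circle_int (\<lambda>s. U (exp s)) t) (2 * pi * U 0) < e"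
    by (auto elim: eventually_mono)
qed

lemma circle_int_affine:
  assumes k: "continuous_on {s. Re s < 0} k" and t: "t < 0"
  shows "circle_int (\<lambda>s. a + b * k s) t = 2 * pi * a + b * circle_int k t"
proof -
  have i: "(\<lambda>\<theta>. k (Complex t \<theta>)) integrable_on {0..2 * pi}"
    by (intro integrable_continuous_real continuous_on_vline[OF k t])
  have "integral {0..2 * pi} (\<lambda>\<theta>. a + b * k (Complex t \<theta>)) =
      integral {0..2 * pi} (\<lambda>\<theta>. a) + integral {0..2 * pi} (\<lambda>\<theta>. b * k (Complex t \<theta>))"
    by (intro integral_add integrable_on_mult_right i) auto
  then show ?thesis
    by (simp add: circle_int_def)
qed

lemma continuous_on_comp_holomorphic:
  assumes "continuous_on (closure S) u" "f holomorphic_on W" "\<And>w. w \<in> W \<Longrightarrow> plane (f w) \<in> S"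
  shows "continuous_on W (\<lambda>w. u (plane (f w)))"
proof (rule continuous_on_compose2[OF assms(1)])
  show "continuous_on W (\<lambda>w. plane (f w))"
    by (intro continuous_on_plane holomorphic_on_imp_continuous_on assms(2))
  show "(\<lambda>w. plane (f w)) ` W \<subseteq> closure S"
    using assms(3) closure_subset by blast
qed

text \<open>The mean value property, read off from Cauchy's formula after rescaling \<open>{0..1}\<close> to
  \<open>{0..2 * pi}\<close>.\<close>

lemma circle_int_holomorphic:
  assumes h: "h holomorphic_on ball 0 1" and t: "t < 0"
  shows "circle_int (\<lambda>s. Re (h (exp s))) t = 2 * pi * Re (h 0)"
proof -
  define r where "r = exp t"
  have r: "0 < r" "r < 1" using t by (auto simp: r_def)
  have "((\<lambda>u. h u / (u - 0)) has_contour_integral 2 * of_real pi * \<i> * h 0) (circlepath 0 r)"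
    by (rule Cauchy_integral_circlepath_simple)
      (use r in \<open>auto intro: holomorphic_on_subset[OF h]\<close>)
  then have "((\<lambda>x. (2 * pi * \<i>) * h (r * exp (2 * of_real pi * \<i> * of_real x))) has_integral (2 * pi * \<i>) * h 0) {0..1}"
    unfolding has_contour_integral vector_derivative_circlepath
    using r by (simp add: circlepath_def mult_ac part_circlepath_def linepath_def)
  from has_integral_mult_right[OF this, of "inverse (2 * pi * \<i>)"]
  have "((\<lambda>x. h (r * exp (2 * of_real pi * \<i> * of_real x))) has_integral h 0) {0..1}"
    by (simp add: field_simps)
  from has_integral_linear[OF this bounded_linear_Re]
  have "((\<lambda>x. Re (h (r * exp (2 * of_real pi * \<i> * of_real x)))) has_integral Re (h 0)) {0..1}"
    by (simp add: o_def)
  from has_integral_stretch_real[OF this, of "1 / (2 * pi)"]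
  have "((\<lambda>\<theta>. Re (h (r * exp (\<i> * of_real \<theta>)))) has_integral 2 * pi * Re (h 0)) ((\<lambda>x. x * (2 * pi)) ` {0..1})"
    by (simp add: mult_ac)
  moreover have "(\<lambda>x. x * (2 * pi)) ` {0..1} = {0..2 * pi}"
    using image_mult_atLeastAtMost[of "2 * pi" 0 1] by (simp add: mult.commute)
  moreover have "exp (Complex t \<theta>) = r * exp (\<i> * of_real \<theta>)" for \<theta>
    by (simp add: Complex_eq exp_add r_def exp_of_real)
  ultimately show ?thesis
    by (simp add: circle_int_def integral_unique)
qed

text \<open>Taylor's formula with integral remainder, based at a point \<open>\<xi>\<close> far to the left. The term
  \<open>(T - \<xi>) * m' \<xi>\<close> is made small by the choice of \<open>\<xi>\<close>: the mean value theorem on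
  \<open>{S..S / 2}\<close> yields a \<open>\<xi>\<close> with \<open>\<bar>\<xi> * m' \<xi>\<bar> \<le> 2 * \<bar>m (S / 2) - m S\<bar>\<close>, and the right-hand side is small because
  \<open>m\<close> converges.\<close>

lemma taylor_at_bot_bound:
  fixes m m' m'' :: "real \<Rightarrow> real"
  assumes m: "\<And>t. t < 0 \<Longrightarrow> (m has_real_derivative m' t) (at t)"
    and m': "\<And>t. t < 0 \<Longrightarrow> (m' has_real_derivative m'' t) (at t)"
    and lim: "(m \<longlongrightarrow> a) at_bot"
    and T: "T < 0"
    and C: "\<And>S. S < T \<Longrightarrow> \<bar>integral {S..T} (\<lambda>t. (T - t) * m'' t)\<bar> \<le> C"
  shows "\<bar>m T - a\<bar> \<le> C"
proof (rule field_le_epsilon)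
  fix e :: real assume "e > 0"
  then have "\<forall>\<^sub>F s in at_bot. dist (m s) a < e / 5"
    by (intro tendstoD[OF lim]) auto
  then obtain N where N: "\<And>s. s \<le> N \<Longrightarrow> \<bar>m s - a\<bar> < e / 5"
    by (auto simp: eventually_at_bot_linorder dist_real_def)
  \<comment> \<open>ensures that \<open>S / 2\<close> lies left of both \<open>N\<close> and \<open>T\<close>\<close>
  define S where "S = 2 * min N T - 1"
  have S: "S < S / 2" "S / 2 < T" "S / 2 \<le> N"
    using T by (auto simp: S_def min_def)
  obtain \<xi> where \<xi>: "S < \<xi>" "\<xi> < S / 2" and mvt: "m (S / 2) - m S = (S / 2 - S) * m' \<xi>"
    using MVT2[OF S(1), of m m'] m S T by (smt (verit))
  have "\<bar>(T - \<xi>) * m' \<xi>\<bar> \<le> \<bar>2 * (S / 2 - S) * m' \<xi>\<bar>"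
    unfolding abs_mult by (intro mult_right_mono) (use \<xi> S T in auto)
  also have "\<dots> = 2 * \<bar>m (S / 2) - m S\<bar>"
    unfolding mvt by (simp add: abs_mult)
  also have "\<dots> \<le> 2 * (\<bar>m (S / 2) - a\<bar> + \<bar>m S - a\<bar>)"
    using abs_triangle_ineq4[of "m (S / 2) - a" "m S - a"] by simp
  also have "\<dots> \<le> 2 * (e / 5 + e / 5)"
    by (intro mult_left_mono add_mono N[THEN less_imp_le]) (use S in auto)
  also have "\<dots> = 4 * (e / 5)" by simp
  finally have small: "\<bar>(T - \<xi>) * m' \<xi>\<bar> \<le> 4 * (e / 5)" .
  have "((\<lambda>t. (T - t) * m'' t) has_integral
      (m T + (T - T) * m' T) - (m \<xi> + (T - \<xi>) * m' \<xi>)) {\<xi>..T}"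
  proof (rule fundamental_theorem_of_calculus)
    fix t assume "t \<in> {\<xi>..T}"
    then have "((\<lambda>t. m t + (T - t) * m' t) has_real_derivative (T - t) * m'' t) (at t)"
      using T by (auto intro!: derivative_eq_intros m m')
    then show "((\<lambda>t. m t + (T - t) * m' t) has_vector_derivative (T - t) * m'' t)
        (at t within {\<xi>..T})"
      by (auto simp: has_real_derivative_iff_has_vector_derivative
          intro: has_vector_derivative_at_within)
  qed (use \<xi> S in auto)
  then have "m T = m \<xi> + (T - \<xi>) * m' \<xi> + integral {\<xi>..T} (\<lambda>t. (T - t) * m'' t)"
    by (simp add: integral_unique)
  moreover have "\<bar>integral {\<xi>..T} (\<lambda>t. (T - t) * m'' t)\<bar> \<le> C"
    using C \<xi> S by auto
  moreover have "\<bar>m \<xi> - a\<bar> < e / 5"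
    using N \<xi> S by auto
  ultimately show "\<bar>m T - a\<bar> \<le> C + e"
    using small by linarith
qed

section \<open>Area integrals under a conformal change of variables\<close>

lemma Basis_real2: "Basis = {axis 1 1, axis 2 (1::real) :: real ^ 2}"
  by (auto simp: Basis_vec_def UNIV_2)

lemma measurable_plane_Complex [measurable]:
  "(\<lambda>(a, b). plane (Complex a b)) \<in> borel_measurable (lborel \<Otimes>\<^sub>M lborel)"
proof -
  have "continuous_on UNIV (\<lambda>(a, b). plane (Complex a b))"
    unfolding split_beta Complex_eq by (intro continuous_intros)
  then show ?thesis
    by (simp add: borel_measurable_continuous_onI lborel_prod)
qed

text \<open>The product measure and the vector space measure agree on boxes.\<close>

lemma lborel_real2:
  "lborel = distr (lborel \<Otimes>\<^sub>M lborel) borel (\<lambda>(a, b). plane (Complex a b))"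
proof (rule lborel_eqI)
  fix l u :: "real ^ 2"
  assume "\<And>b. b \<in> Basis \<Longrightarrow> l \<bullet> b \<le> u \<bullet> b"
  from this[of "axis 1 1"] this[of "axis 2 1"] have le: "l $ 1 \<le> u $ 1" "l $ 2 \<le> u $ 2"
    by (simp_all add: Basis_real2 inner_axis)
  have "(\<lambda>(a, b). plane (Complex a b)) -` box l u \<inter> space (lborel \<Otimes>\<^sub>M lborel)
      = {l $ 1 <..< u $ 1} \<times> {l $ 2 <..< u $ 2}"
    by (auto simp: mem_box_cart forall_2 space_pair_measure)
  then show "emeasure (distr (lborel \<Otimes>\<^sub>M lborel) borel (\<lambda>(a, b). plane (Complex a b))) (box l u)
      = ennreal (\<Prod>b\<in>Basis. (u - l) \<bullet> b)"
    using le by (simp add: emeasure_distr lborel.emeasure_pair_measure_Times Basis_real2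
        inner_axis axis_eq_axis ennreal_mult inner_diff_left)
qed simp

lemma nn_integral_real2:
  fixes f :: "real ^ 2 \<Rightarrow> ennreal"
  assumes [measurable]: "f \<in> borel_measurable borel"
  shows "(\<integral>\<^sup>+v. f v \<partial>lborel) = (\<integral>\<^sup>+a. \<integral>\<^sup>+b. f (plane (Complex a b)) \<partial>lborel \<partial>lborel)"
proof -
  have "(\<integral>\<^sup>+v. f v \<partial>lborel) = (\<integral>\<^sup>+p. f (case p of (a, b) \<Rightarrow> plane (Complex a b)) \<partial>(lborel \<Otimes>\<^sub>M lborel))"
    by (subst lborel_real2, subst nn_integral_distr) auto
  also have "\<dots> = (\<integral>\<^sup>+a. \<integral>\<^sup>+b. f (plane (Complex a b)) \<partial>lborel \<partial>lborel)"
    by (subst lborel.nn_integral_fst[symmetric]) auto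
  finally show ?thesis .
qed

text \<open>If the right-hand side is finite, then \<open>f\<close> is absolutely integrable on the image and the change of
  variables formula for signed integrands gives equality; it is stated for vector-valued functions,
  whence the passage through one-dimensional vectors.\<close>

lemma nn_integral_change_of_variables_le:
  fixes g :: "real ^ 'n::{finite,wellorder} \<Rightarrow> real ^ 'n::_" and f :: "real ^ 'n::_ \<Rightarrow> real"
  assumes S: "S \<in> sets lebesgue"
    and der: "\<And>x. x \<in> S \<Longrightarrow> (g has_derivative g' x) (at x within S)"
    and inj: "inj_on g S"
    and f: "set_borel_measurable borel (g ` S) f" "\<And>y. y \<in> g ` S \<Longrightarrow> 0 \<le> f y"
  shows "(\<integral>\<^sup>+x\<in>S. ennreal (\<bar>det (matrix (g' x))\<bar> * f (g x)) \<partial>lborel) \<le> (\<integral>\<^sup>+y\<in>g ` S. ennreal (f y) \<partial>lborel)"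
proof (cases "(\<integral>\<^sup>+y\<in>g ` S. ennreal (f y) \<partial>lborel) < \<infinity>")
  case True
  have "set_integrable lborel (g ` S) f"
    unfolding set_integrable_def
  proof (rule integrableI_nonneg)
    show "(\<lambda>x. indicator (g ` S) x *\<^sub>R f x) \<in> borel_measurable lborel"
      using f(1) by (simp add: set_borel_measurable_def)
    show "AE x in lborel. 0 \<le> indicator (g ` S) x *\<^sub>R f x"
      using f(2) by (auto simp: indicator_def)
    show "(\<integral>\<^sup>+x. ennreal (indicator (g ` S) x *\<^sub>R f x) \<partial>lborel) < \<infinity>"
      using True by (simp add: nn_integral_set_ennreal mult.commute)
  qed
  then have "f absolutely_integrable_on (g ` S)"
    by (simp add: set_integrable_def integrable_completion)
  then have ai: "(\<lambda>x. vec (f x) :: real ^ 1) absolutely_integrable_on (g ` S)"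
    by (simp add: absolutely_integrable_on_1_iff)
  let ?I = "integral (g ` S) f"
  have "(\<lambda>x. \<bar>det (matrix (g' x))\<bar> *\<^sub>R (vec (f (g x)) :: real ^ 1)) absolutely_integrable_on S \<and>
      integral S (\<lambda>x. \<bar>det (matrix (g' x))\<bar> *\<^sub>R (vec (f (g x)) :: real ^ 1)) = vec ?I"
    using has_absolute_integral_change_of_variables[OF S der inj, of "\<lambda>x. vec (f x) :: real ^ 1" "vec ?I"] ai
    by (simp add: integral_on_1_eq)
  then have "(\<lambda>x. \<bar>det (matrix (g' x))\<bar> * f (g x)) integrable_on S"
    "integral S (\<lambda>x. \<bar>det (matrix (g' x))\<bar> * f (g x)) = ?I"
    by (auto simp: absolutely_integrable_on_1_iff integral_on_1_eq vec_eq_iff absolutely_integrable_on_def)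
  then have "((\<lambda>x. \<bar>det (matrix (g' x))\<bar> * f (g x)) has_integral ?I) S"
    by (simp add: has_integral_iff)
  then have "(\<integral>\<^sup>+x\<in>S. ennreal (\<bar>det (matrix (g' x))\<bar> * f (g x)) \<partial>lborel) = ennreal ?I"
    by (intro nn_integral_has_integral_lebesgue') (use f(2) in auto)
  moreover have "(f has_integral ?I) (g ` S)"
    using \<open>f absolutely_integrable_on (g ` S)\<close> by (simp add: absolutely_integrable_on_def has_integral_iff)
  then have "(\<integral>\<^sup>+y\<in>g ` S. ennreal (f y) \<partial>lborel) = ennreal ?I"
    by (intro nn_integral_has_integral_lebesgue') (use f(2) in auto)
  ultimately show ?thesis by simp
next
  case False
  then have "(\<integral>\<^sup>+y\<in>g ` S. ennreal (f y) \<partial>lborel) = top"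
    by (metis infinity_ennreal_def less_top)
  then show ?thesis by simp
qed

lemma has_derivative_conformal:
  assumes "(\<Psi> has_field_derivative D) (at (Complex (v $ 1) (v $ 2)))"
  defines "L \<equiv> (\<lambda>h. plane (D * Complex (h $ 1) (h $ 2)))"
  shows "((\<lambda>v. plane (\<Psi> (Complex (v $ 1) (v $ 2)))) has_derivative L) (at v)"
    and "det (matrix L) = (cmod D)\<^sup>2"
proof -
  have bl: "bounded_linear (\<lambda>h::real^2. Complex (h $ 1) (h $ 2))"
    unfolding Complex_eq
    by (intro bounded_linear_add bounded_linear_const_mult)
      (auto intro!: bounded_linear_compose[OF bounded_linear_of_real] bounded_linear_vec_nth)
  have "((\<lambda>v::real^2. \<Psi> (Complex (v $ 1) (v $ 2))) has_derivative (\<lambda>h. D * Complex (h $ 1) (h $ 2))) (at v)"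
    by (rule has_derivative_compose[OF bounded_linear_imp_has_derivative[OF bl]
        assms(1)[unfolded has_field_derivative_def]])
  then show "((\<lambda>v. plane (\<Psi> (Complex (v $ 1) (v $ 2)))) has_derivative L) (at v)"
    unfolding L_def by (rule bounded_linear.has_derivative[OF bounded_linear_plane])
  show "det (matrix L) = (cmod D)\<^sup>2"
    unfolding cmod_power2
    by (simp add: det_2 matrix_def L_def axis_def power2_eq_square)
qed

lemma ennreal_circle_int_le:
  assumes q: "continuous_on {s. Re s < 0} q" and t: "t < 0"
  shows "ennreal \<bar>circle_int q t\<bar> \<le> (\<integral>\<^sup>+\<theta>\<in>{0<..<2 * pi}. ennreal \<bar>q (Complex t \<theta>)\<bar> \<partial>lborel)"
proof -
  have c: "continuous_on {0..2 * pi} (\<lambda>\<theta>. \<bar>q (Complex t \<theta>)\<bar>)"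
    by (intro continuous_intros continuous_on_vline[OF q t])
  have i: "(\<lambda>\<theta>. q (Complex t \<theta>)) integrable_on {0..2 * pi}"
    by (intro integrable_continuous_real continuous_on_vline[OF q t])
  have "\<bar>circle_int q t\<bar> \<le> integral {0..2 * pi} (\<lambda>\<theta>. \<bar>q (Complex t \<theta>)\<bar>)"
    using integral_norm_bound_integral[OF i integrable_continuous_real[OF c]]
    by (simp add: circle_int_def)
  moreover have "((\<lambda>\<theta>. \<bar>q (Complex t \<theta>)\<bar>) has_integral
      integral {0..2 * pi} (\<lambda>\<theta>. \<bar>q (Complex t \<theta>)\<bar>)) {0<..<2 * pi}"
    using integrable_integral[OF integrable_continuous_real[OF c]]
      has_integral_open_interval[of "\<lambda>\<theta>. \<bar>q (Complex t \<theta>)\<bar>" _ 0 "2 * pi"] by simp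
  then have "(\<integral>\<^sup>+\<theta>\<in>{0<..<2 * pi}. ennreal \<bar>q (Complex t \<theta>)\<bar> \<partial>lborel)
      = ennreal (integral {0..2 * pi} (\<lambda>\<theta>. \<bar>q (Complex t \<theta>)\<bar>))"
    by (intro nn_integral_has_integral_lebesgue') auto
  ultimately show ?thesis by (simp add: ennreal_leI)
qed

text \<open>The remainder of Taylor's formula for the circle integrals, moved to the domain. With
  \<open>T - t \<le> - t \<le> c * K\<close> the integrand is at most \<open>c * K * \<bar>h\<bar>\<close> times the Jacobian \<open>\<bar>\<Psi>'\<bar>\<^sup>2\<close>; on the open strip, which
  differs from a full period by a null set, \<open>\<Psi>\<close> is injective.\<close>

lemma strip_integral_le:
  fixes h K :: "real ^ 2 \<Rightarrow> real"
  assumes hol: "\<Psi> holomorphic_on {s. Re s < 0}"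
    and inj: "inj_on \<Psi> {s. Re s < 0 \<and> 0 < Im s \<and> Im s < 2 * pi}"
    and into: "\<And>s. Re s < 0 \<Longrightarrow> plane (\<Psi> s) \<in> S"
    and S: "open S" and h: "continuous_on S h" and K: "K \<in> borel_measurable borel"
    and K_ge: "\<And>s. Re s < 0 \<Longrightarrow> - Re s \<le> c * K (plane (\<Psi> s))"
    and c: "c \<ge> 0" and T: "T < 0" and AT: "A \<le> T"
  shows "ennreal \<bar>integral {A..T} (\<lambda>t. (T - t) *
            circle_int (\<lambda>s. h (plane (\<Psi> s)) * (cmod (deriv \<Psi> s))\<^sup>2) t)\<bar>
       \<le> ennreal c * (\<integral>\<^sup>+y\<in>S. ennreal (K y * \<bar>h y\<bar>) \<partial>lborel)"
proof -
  define q where "q = (\<lambda>s. h (plane (\<Psi> s)) * (cmod (deriv \<Psi> s))\<^sup>2)"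
  define W where "W = {s. Re s < 0 \<and> 0 < Im s \<and> Im s < 2 * pi}"
  define g where "g = (\<lambda>v::real^2. plane (\<Psi> (Complex (v $ 1) (v $ 2))))"
  define D where "D = (\<lambda>v::real^2. deriv \<Psi> (Complex (v $ 1) (v $ 2)))"
  define f where "f = (\<lambda>y. c * (K y * \<bar>h y\<bar>))"
  define F where "F = (\<lambda>v::real^2. ennreal (- (v $ 1) * \<bar>q (Complex (v $ 1) (v $ 2))\<bar>) * indicator (plane ` W) v)"
  have H: "open {s. Re s < 0}" by (rule open_halfspace_Re_lt)
  have q: "continuous_on {s. Re s < 0} q"
    unfolding q_def
    by (intro continuous_intros continuous_on_compose2[OF h] holomorphic_on_imp_continuous_on
        holomorphic_deriv hol H) (use into in auto)
  have memW: "v \<in> plane ` W \<longleftrightarrow> v $ 1 < 0 \<and> 0 < v $ 2 \<and> v $ 2 < 2 * pi" for v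
    unfolding W_def image_iff using plane_Complex[of v, symmetric]
    by (auto intro!: exI[of _ "Complex (v $ 1) (v $ 2)"])
  have "W = {s. Re s < 0} \<inter> {s. 0 < Im s} \<inter> {s. Im s < 2 * pi}"
    by (auto simp: W_def)
  then have W: "open W"
    using open_halfspace_Re_lt[of 0] open_halfspace_Im_gt[of 0] open_halfspace_Im_lt[of "2 * pi"]
    by (simp add: open_Int)
  have image_g: "g ` (plane ` W) = plane ` \<Psi> ` W"
    by (auto simp: g_def image_image)
  have "open (\<Psi> ` W)"
    by (rule open_mapping_thm3[OF _ W]) (use hol inj in \<open>auto simp: W_def intro: holomorphic_on_subset\<close>)
  then have open_g: "open (g ` (plane ` W))"
    unfolding image_g by (rule open_plane_image)
  have gS: "g ` (plane ` W) \<subseteq> S"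
    using into by (auto simp: g_def W_def)
  have K0: "0 \<le> f y" if "y \<in> g ` (plane ` W)" for y
  proof -
    obtain s where "s \<in> W" "y = plane (\<Psi> s)"
      using \<open>y \<in> _\<close> unfolding image_g by auto
    then have "0 \<le> c * K y"
      using K_ge[of s] by (auto simp: W_def)
    then have "0 \<le> (c * K y) * \<bar>h y\<bar>" by simp
    then show ?thesis by (simp add: f_def mult.assoc)
  qed
  have "ennreal \<bar>integral {A..T} (\<lambda>t. (T - t) * circle_int q t)\<bar> \<le>
      ennreal (integral {A..T} (\<lambda>t. (T - t) * \<bar>circle_int q t\<bar>))"
  proof (rule ennreal_leI)
    have ci: "continuous_on {A..T} (circle_int q)"
      by (rule continuous_on_subset[OF continuous_on_circle_int[OF q]]) (use T in auto)
    have "norm (integral {A..T} (\<lambda>t. (T - t) * circle_int q t)) \<le>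
        integral {A..T} (\<lambda>t. (T - t) * \<bar>circle_int q t\<bar>)"
      by (intro integral_norm_bound_integral integrable_continuous_real continuous_intros ci)
        (auto simp: abs_mult)
    then show "\<bar>integral {A..T} (\<lambda>t. (T - t) * circle_int q t)\<bar> \<le>
        integral {A..T} (\<lambda>t. (T - t) * \<bar>circle_int q t\<bar>)" by simp
  qed
  also have "\<dots> = (\<integral>\<^sup>+t\<in>{A..T}. ennreal ((T - t) * \<bar>circle_int q t\<bar>) \<partial>lborel)"
  proof -
    have "continuous_on {A..T} (circle_int q)"
      by (rule continuous_on_subset[OF continuous_on_circle_int[OF q]]) (use T in auto)
    then have "((\<lambda>t. (T - t) * \<bar>circle_int q t\<bar>) has_integral
        integral {A..T} (\<lambda>t. (T - t) * \<bar>circle_int q t\<bar>)) {A..T}"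
      by (intro integrable_integral integrable_continuous_real continuous_intros)
    then show ?thesis
      by (intro nn_integral_has_integral_lebesgue'[symmetric]) auto
  qed
  also have "\<dots> \<le> (\<integral>\<^sup>+t. \<integral>\<^sup>+\<theta>. F (plane (Complex t \<theta>)) \<partial>lborel \<partial>lborel)"
  proof (rule nn_integral_mono)
    fix t :: real
    show "ennreal ((T - t) * \<bar>circle_int q t\<bar>) * indicator {A..T} t \<le>
        (\<integral>\<^sup>+\<theta>. F (plane (Complex t \<theta>)) \<partial>lborel)"
    proof (cases "t \<in> {A..T}")
      case True
      then have t: "t < 0" using T by auto
      have "ennreal ((T - t) * \<bar>circle_int q t\<bar>) \<le> ennreal (- t) * ennreal \<bar>circle_int q t\<bar>"
      proof -
        have "(T - t) * \<bar>circle_int q t\<bar> \<le> (- t) * \<bar>circle_int q t\<bar>"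
          using T by (intro mult_right_mono) auto
        then show ?thesis
          using t by (simp add: ennreal_mult[symmetric] ennreal_leI)
      qed
      also have "\<dots> \<le> ennreal (- t) * (\<integral>\<^sup>+\<theta>\<in>{0<..<2 * pi}. ennreal \<bar>q (Complex t \<theta>)\<bar> \<partial>lborel)"
        by (intro mult_left_mono ennreal_circle_int_le q t) auto
      also have "\<dots> = (\<integral>\<^sup>+\<theta>. ennreal (- t) * (ennreal \<bar>q (Complex t \<theta>)\<bar> * indicator {0<..<2 * pi} \<theta>) \<partial>lborel)"
      proof (rule nn_integral_cmult[symmetric])
        have "(\<lambda>\<theta>. indicator {0<..<2 * pi} \<theta> *\<^sub>R \<bar>q (Complex t \<theta>)\<bar>) \<in> borel_measurable borel"
          by (intro borel_measurable_continuous_on_indicator continuous_intros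
              continuous_on_vline[OF q t]) auto
        then have "(\<lambda>\<theta>. ennreal (indicator {0<..<2 * pi} \<theta> *\<^sub>R \<bar>q (Complex t \<theta>)\<bar>)) \<in> borel_measurable lborel"
          by simp
        then show "(\<lambda>\<theta>. ennreal \<bar>q (Complex t \<theta>)\<bar> * indicator {0<..<2 * pi} \<theta>) \<in> borel_measurable lborel"
          by (rule measurable_cong[THEN iffD1, rotated]) (simp split: split_indicator)
      qed
      also have "\<dots> = (\<integral>\<^sup>+\<theta>. F (plane (Complex t \<theta>)) \<partial>lborel)"
        unfolding F_def using t
        by (intro nn_integral_cong) (auto simp: memW ennreal_mult[symmetric] split: split_indicator)
      finally show ?thesis using True by simp
    qed simp
  qed
  also have "\<dots> = (\<integral>\<^sup>+v. F v \<partial>lborel)"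
  proof (rule nn_integral_real2[symmetric])
    have "(\<lambda>v. indicator (plane ` W) v *\<^sub>R (- (v $ 1) * \<bar>q (Complex (v $ 1) (v $ 2))\<bar>)) \<in> borel_measurable borel"
    proof (rule borel_measurable_continuous_on_indicator)
      show "continuous_on (plane ` W) (\<lambda>v. - (v $ 1) * \<bar>q (Complex (v $ 1) (v $ 2))\<bar>)"
        by (intro continuous_intros continuous_on_compose2[OF q])
          (auto simp: Complex_eq W_def intro!: continuous_intros)
    qed (use open_plane_image[OF W] in auto)
    then have "(\<lambda>v. ennreal (indicator (plane ` W) v *\<^sub>R (- (v $ 1) * \<bar>q (Complex (v $ 1) (v $ 2))\<bar>))) \<in> borel_measurable borel"
      by simp
    then show "F \<in> borel_measurable borel"
      unfolding F_def by (rule measurable_cong[THEN iffD1, rotated]) (simp split: split_indicator)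
  qed
  also have "\<dots> \<le> (\<integral>\<^sup>+v\<in>plane ` W. ennreal (\<bar>det (matrix (\<lambda>h. plane (D v * Complex (h $ 1) (h $ 2))))\<bar> * f (g v)) \<partial>lborel)"
  proof (rule nn_integral_mono)
    fix v :: "real ^ 2"
    show "F v \<le> ennreal (\<bar>det (matrix (\<lambda>h. plane (D v * Complex (h $ 1) (h $ 2))))\<bar> * f (g v)) * indicator (plane ` W) v"
    proof (cases "v \<in> plane ` W")
      case True
      let ?s = "Complex (v $ 1) (v $ 2)"
      have s: "Re ?s < 0" using True memW by auto
      have "(\<Psi> has_field_derivative D v) (at ?s)"
        unfolding D_def using holomorphic_derivI[OF hol H, of ?s] s by simp
      note det = has_derivative_conformal(2)[OF this]
      have "- (v $ 1) * \<bar>h (g v)\<bar> * (cmod (D v))\<^sup>2 \<le> c * K (g v) * \<bar>h (g v)\<bar> * (cmod (D v))\<^sup>2"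
        using K_ge[OF s] by (intro mult_right_mono) (auto simp: g_def)
      moreover have "q ?s = h (g v) * (cmod (D v))\<^sup>2"
        by (simp add: q_def g_def D_def)
      ultimately show ?thesis
        using True unfolding F_def f_def det
        by (simp add: abs_mult mult_ac ennreal_leI)
    qed (simp add: F_def)
  qed
  also have "\<dots> \<le> (\<integral>\<^sup>+y\<in>g ` (plane ` W). ennreal (f y) \<partial>lborel)"
  proof (rule nn_integral_change_of_variables_le)
    show "plane ` W \<in> sets lebesgue"
      using open_plane_image[OF W] by auto
    show "(g has_derivative (\<lambda>h. plane (D v * Complex (h $ 1) (h $ 2)))) (at v within plane ` W)"
      if "v \<in> plane ` W" for v
    proof -
      have "Re (Complex (v $ 1) (v $ 2)) < 0" using that memW by auto
      then have "(\<Psi> has_field_derivative D v) (at (Complex (v $ 1) (v $ 2)))"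
        unfolding D_def using holomorphic_derivI[OF hol H, of "Complex (v $ 1) (v $ 2)"] by simp
      then show ?thesis
        unfolding g_def by (rule has_derivative_at_withinI[OF has_derivative_conformal(1)])
    qed
    show "inj_on g (plane ` W)"
      using inj by (auto simp: inj_on_def g_def W_def)
    have "continuous_on (g ` plane ` W) h"
      by (rule continuous_on_subset[OF h gS])
    then have "(\<lambda>y. indicator (g ` plane ` W) y *\<^sub>R \<bar>h y\<bar>) \<in> borel_measurable borel"
      using open_g by (intro borel_measurable_continuous_on_indicator continuous_intros) auto
    then have "(\<lambda>y. c * K y * (indicator (g ` plane ` W) y *\<^sub>R \<bar>h y\<bar>)) \<in> borel_measurable borel"
      using K by measurable
    then show "set_borel_measurable borel (g ` plane ` W) f"
      unfolding set_borel_measurable_def f_def by (simp add: mult_ac)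
  qed (use K0 in auto)
  also have "\<dots> \<le> (\<integral>\<^sup>+y\<in>S. ennreal (f y) \<partial>lborel)"
    using gS by (intro nn_integral_mono) (auto split: split_indicator)
  also have "\<dots> = (\<integral>\<^sup>+y. ennreal c * (ennreal (K y * \<bar>h y\<bar>) * indicator S y) \<partial>lborel)"
    using c by (intro nn_integral_cong) (auto simp: f_def ennreal_mult' split: split_indicator)
  also have "\<dots> = ennreal c * (\<integral>\<^sup>+y\<in>S. ennreal (K y * \<bar>h y\<bar>) \<partial>lborel)"
  proof (rule nn_integral_cmult)
    have "(\<lambda>y. indicator S y *\<^sub>R \<bar>h y\<bar>) \<in> borel_measurable borel"
      using S h by (intro borel_measurable_continuous_on_indicator continuous_intros) auto
    then have "(\<lambda>y. ennreal (K y * (indicator S y *\<^sub>R \<bar>h y\<bar>))) \<in> borel_measurable borel"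
      using K by measurable
    then have "(\<lambda>y. ennreal (K y * (indicator S y *\<^sub>R \<bar>h y\<bar>))) \<in> borel_measurable lborel"
      by simp
    then show "(\<lambda>y. ennreal (K y * \<bar>h y\<bar>) * indicator S y) \<in> borel_measurable lborel"
      by (rule measurable_cong[THEN iffD1, rotated]) (simp split: split_indicator)
  qed
  finally show ?thesis
    unfolding q_def .
qed

section \<open>Riemann maps and circles near the boundary\<close>

text \<open>The Riemann map is normalised at \<open>x\<close> by composing with a disc automorphism. The inverse \<open>G\<close> is
  kept because its continuity makes \<open>\<phi>\<close> proper.\<close>

lemma riemann_map_plane:
  assumes S: "open S" "simply_connected S" "S \<noteq> UNIV" and x: "x \<in> S"
  obtains \<phi> G where
    "\<phi> holomorphic_on ball 0 1" "plane (\<phi> 0) = x"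
    "\<And>w. w \<in> ball 0 1 \<Longrightarrow> plane (\<phi> w) \<in> S \<and> G (\<phi> w) = w"
    "continuous_on {z. plane z \<in> S} G"
    "\<And>z. plane z \<in> S \<Longrightarrow> G z \<in> ball 0 1 \<and> \<phi> (G z) = z"
proof -
  define U where "U = {z. plane z \<in> S}"
  have U: "open U" "simply_connected U"
    using open_plane_vimage[OF S(1)] homeomorphic_simply_connected_eq[OF homeomorphic_plane] S(2)
    by (auto simp: U_def)
  obtain z0 where z0: "plane z0 = x"
    by (metis plane_Complex)
  have "U \<noteq> {}" "U \<noteq> UNIV"
    using z0 x S(3) by (auto simp: U_def) (metis UNIV_I UNIV_eq_I mem_Collect_eq plane_Complex)
  then obtain f g where f: "f holomorphic_on U" and g: "g holomorphic_on ball 0 1"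
      and fU: "\<And>z. z \<in> U \<Longrightarrow> f z \<in> ball 0 1 \<and> g (f z) = z"
      and gB: "\<And>w. w \<in> ball 0 1 \<Longrightarrow> g w \<in> U \<and> f (g w) = w"
    using simply_connected_eq_biholomorphic_to_disc[OF U(1)] U(2) by blast
  have z0U: "z0 \<in> U" using z0 x by (simp add: U_def)
  then obtain p q where pq: "p (f z0) = 0"
      "p holomorphic_on ball 0 1" "p ` ball 0 1 \<subseteq> ball 0 1"
      "q holomorphic_on ball 0 1" "q ` ball 0 1 \<subseteq> ball 0 1"
      "\<And>w. w \<in> ball 0 1 \<Longrightarrow> p (q w) = w"
      "\<And>w. w \<in> ball 0 1 \<Longrightarrow> q (p w) = w"
    using ball_biholomorphism_exists[of "f z0"] fU by metis
  show ?thesis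
  proof (rule that[of "g \<circ> q" "p \<circ> f"])
    show "g \<circ> q holomorphic_on ball 0 1"
      by (rule holomorphic_on_compose_gen[OF pq(4) g]) (use pq in auto)
    have "q 0 = f z0" using pq fU[OF z0U] by metis
    then show "plane ((g \<circ> q) 0) = x" using z0 fU[OF z0U] by simp
    show "plane ((g \<circ> q) w) \<in> S \<and> (p \<circ> f) ((g \<circ> q) w) = w" if "w \<in> ball 0 1" for w
    proof -
      have "q w \<in> ball 0 1" using pq(5) that by blast
      then show ?thesis using gB pq(6) that by (auto simp: U_def)
    qed
    have "p \<circ> f holomorphic_on U"
      by (rule holomorphic_on_compose_gen[OF f pq(2)]) (use fU in auto)
    then show "continuous_on {z. plane z \<in> S} (p \<circ> f)"
      unfolding U_def by (rule holomorphic_on_imp_continuous_on)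
    show "(p \<circ> f) z \<in> ball 0 1 \<and> (g \<circ> q) ((p \<circ> f) z) = z" if "plane z \<in> S" for z
    proof -
      have z: "z \<in> U" using that by (simp add: U_def)
      then have "p (f z) \<in> ball 0 1" using pq(3) fU by blast
      then show ?thesis using fU[OF z] pq(7) by auto
    qed
  qed
qed

lemma holomorphic_sqrt_ball:
  assumes "f holomorphic_on ball 0 1" "\<And>w. w \<in> ball 0 1 \<Longrightarrow> f w \<noteq> 0"
  obtains g where "g holomorphic_on ball 0 1" "\<And>w. w \<in> ball 0 1 \<Longrightarrow> f w = (g w)\<^sup>2"
  using simply_connected_eq_holomorphic_sqrt[OF open_ball, of 0 1]
    convex_imp_simply_connected[OF convex_ball, of 0 1] assms
  by (metis (no_types, lifting))

lemma holomorphic_log_ball: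
  assumes "f holomorphic_on ball 0 1" "\<And>w. w \<in> ball 0 1 \<Longrightarrow> f w \<noteq> 0"
  obtains g where "g holomorphic_on ball 0 1" "\<And>w. w \<in> ball 0 1 \<Longrightarrow> f w = exp (g w)"
  using simply_connected_eq_holomorphic_log[OF open_ball, of 0 1]
    convex_imp_simply_connected[OF convex_ball, of 0 1] assms
  by (metis (no_types, lifting))

text \<open>Let \<open>g\<^sup>2 = \<phi> - z\<close>. As \<open>\<phi>\<close> is injective, \<open>g\<close> never takes two opposite values; since its image contains a
  disc of radius \<open>e\<close> about \<open>g 0\<close>, it omits the disc of radius \<open>e\<close> about \<open>- g 0\<close>. Hence \<open>(g + g 0) / e\<close>
  has modulus at least one, and its logarithm is the required \<open>h\<close>.\<close>

lemma injective_holomorphic_majorant: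
  assumes hol: "\<phi> holomorphic_on ball 0 1" and inj: "inj_on \<phi> (ball 0 1)"
    and z: "z \<notin> \<phi> ` ball 0 1"
  obtains h where "h holomorphic_on ball 0 1" "\<And>w. w \<in> ball 0 1 \<Longrightarrow> Re (h w) \<ge> 0"
    "\<And>L. \<exists>R. \<forall>w\<in>ball 0 1. norm (\<phi> w) > R \<longrightarrow> Re (h w) \<ge> L"
proof -
  obtain g where g: "g holomorphic_on ball 0 1" and sq: "\<And>w. w \<in> ball 0 1 \<Longrightarrow> \<phi> w - z = (g w)\<^sup>2"
    by (rule holomorphic_sqrt_ball[of "\<lambda>w. \<phi> w - z"])
      (use hol z in \<open>auto intro!: holomorphic_intros\<close>)
  have g0: "g w \<noteq> 0" if "w \<in> ball 0 1" for w
    using sq[OF that] z that by (metis eq_iff_diff_eq_0 imageI zero_power2)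
  have "inj_on g (ball 0 1)"
    by (rule inj_onI) (metis diff_add_cancel inj inj_onD sq)
  then have "open (g ` ball 0 1)"
    using open_mapping_thm3[OF g] by auto
  moreover have "g 0 \<in> g ` ball 0 1" by auto
  ultimately obtain e where e: "e > 0" "ball (g 0) e \<subseteq> g ` ball 0 1"
    using openE by blast
  have far: "e \<le> norm (g w + g 0)" if w: "w \<in> ball 0 1" for w
  proof (rule ccontr)
    assume "\<not> e \<le> norm (g w + g 0)"
    then have "- g w \<in> ball (g 0) e"
      by (simp add: dist_norm add.commute)
    then obtain w' where w': "w' \<in> ball 0 1" "g w' = - g w"
      using e by (metis image_iff subsetD)
    then have "\<phi> w' = \<phi> w"
      using sq[OF w] sq[OF w'(1)] by (metis diff_add_cancel power2_minus)
    then have "w' = w" using inj w w' by (metis inj_onD)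
    then have "2 * g w = 0" using w'(2) by simp
    then show False using g0[OF w] by simp
  qed
  obtain h where h: "h holomorphic_on ball 0 1"
      and exph: "\<And>w. w \<in> ball 0 1 \<Longrightarrow> (g w + g 0) / e = exp (h w)"
  proof (rule holomorphic_log_ball[of "\<lambda>w. (g w + g 0) / e"])
    show "(g w + g 0) / e \<noteq> 0" if "w \<in> ball 0 1" for w
      using far[OF that] e by auto
  qed (use g in \<open>auto intro!: holomorphic_intros\<close>)
  have normh: "exp (Re (h w)) = norm (g w + g 0) / e" if "w \<in> ball 0 1" for w
    using exph[OF that] e by (metis abs_of_pos norm_divide norm_exp_eq_Re norm_of_real)
  show ?thesis
  proof
    show "h holomorphic_on ball 0 1" by (rule h)
    show "Re (h w) \<ge> 0" if "w \<in> ball 0 1" for w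
    proof -
      have "1 \<le> exp (Re (h w))"
        using normh[OF that] far[OF that] e by simp
      then show ?thesis by simp
    qed
    fix L
    define M where "M = e * exp L + norm (g 0)"
    have "Re (h w) \<ge> L" if w: "w \<in> ball 0 1" and big: "norm (\<phi> w) > norm z + M\<^sup>2" for w
    proof -
      have "M\<^sup>2 < norm (\<phi> w - z)"
        using big norm_triangle_ineq2[of "\<phi> w" z] by linarith
      then have "M\<^sup>2 < (norm (g w))\<^sup>2"
        using sq[OF w] by (simp add: norm_power)
      then have "M < norm (g w)"
        by (rule power_less_imp_less_base) auto
      then have "e * exp L \<le> norm (g w + g 0)"
        using norm_diff_ineq[of "g w" "g 0"] by (simp add: M_def)
      then have "exp L \<le> norm (g w + g 0) / e"
        using e by (simp add: pos_le_divide_eq mult.commute)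
      then have "exp L \<le> exp (Re (h w))"
        using normh[OF w] by simp
      then show ?thesis by simp
    qed
    then show "\<exists>R. \<forall>w\<in>ball 0 1. norm (\<phi> w) > R \<longrightarrow> Re (h w) \<ge> L" by blast
  qed
qed

text \<open>Points of the disc near the unit circle are of two kinds. If \<open>\<bar>\<phi> w\<bar> \<le> R\<close>, then \<open>\<bar>u (\<phi> w)\<bar> < \<beta> + e\<close>, since the
  set where this fails is a compact part of the domain and its preimage stays away from the unit
  circle. If \<open>\<bar>\<phi> w\<bar> > R\<close>, only \<open>\<bar>u (\<phi> w)\<bar> \<le> B\<close> is known, and \<open>B\<close> is dominated by \<open>(B / L) * Re (h w)\<close>, a
  harmonic function whose value at \<open>0\<close>, hence its mean, is at most \<open>e\<close>.\<close>

lemma circle_int_near_boundary: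
  fixes u :: "real ^ 2 \<Rightarrow> real"
  assumes S: "open S" "S \<noteq> UNIV"
    and hol: "\<phi> holomorphic_on ball 0 1"
    and \<phi>: "\<And>w. w \<in> ball 0 1 \<Longrightarrow> plane (\<phi> w) \<in> S \<and> G (\<phi> w) = w"
    and contG: "continuous_on {z. plane z \<in> S} G"
    and G: "\<And>z. plane z \<in> S \<Longrightarrow> G z \<in> ball 0 1 \<and> \<phi> (G z) = z"
    and u: "continuous_on (closure S) u"
    and B: "\<And>x. x \<in> S \<Longrightarrow> \<bar>u x\<bar> \<le> B"
    and \<beta>: "\<And>x. x \<in> frontier S \<Longrightarrow> \<bar>u x\<bar> \<le> \<beta>" "\<beta> \<ge> 0"
    and e: "e > 0"
  shows "\<exists>T<0. \<bar>circle_int (\<lambda>s. u (plane (\<phi> (exp s)))) T\<bar> \<le> 2 * pi * (\<beta> + 2 * e)"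
proof -
  have "inj_on \<phi> (ball 0 1)" by (metis \<phi> inj_onI)
  moreover obtain z where "plane z \<notin> S" using S(2) by (metis UNIV_eq_I plane_Complex)
  then have "z \<notin> \<phi> ` ball 0 1" using \<phi> by blast
  ultimately obtain h where h: "h holomorphic_on ball 0 1" "\<And>w. w \<in> ball 0 1 \<Longrightarrow> Re (h w) \<ge> 0"
      "\<And>L. \<exists>R. \<forall>w\<in>ball 0 1. norm (\<phi> w) > R \<longrightarrow> Re (h w) \<ge> L"
    using injective_holomorphic_majorant[OF hol] by blast
  have B0: "B \<ge> 0" using B[of "plane (\<phi> 0)"] \<phi>[of 0] by force
  \<comment> \<open>the added \<open>1\<close> keeps \<open>L\<close> positive even if \<open>B * Re (h 0) = 0\<close>\<close>
  define L where "L = B * Re (h 0) / e + 1"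
  have h0: "B * Re (h 0) \<ge> 0" using B0 h(2)[of 0] by simp
  then have L: "L > 0" using e by (simp add: L_def add_nonneg_pos)
  have BL: "B / L * Re (h 0) \<le> e"
  proof -
    have "B * Re (h 0) \<le> e * L" using e by (simp add: L_def field_simps)
    then show ?thesis using L by (simp add: pos_divide_le_eq)
  qed
  obtain R where R: "\<And>w. w \<in> ball 0 1 \<Longrightarrow> norm (\<phi> w) > R \<Longrightarrow> Re (h w) \<ge> L"
    using h(3) by blast
  define A where "A = (closure S \<inter> (\<lambda>x. \<bar>u x\<bar>) -` {\<beta> + e..}) \<inter> cball 0 R"
  have A: "compact A"
    unfolding A_def
    by (intro closed_Int_compact continuous_closed_preimage continuous_intros u) auto
  have AS: "A \<subseteq> S"
  proof
    fix x assume "x \<in> A"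
    then have "x \<in> closure S" "x \<notin> frontier S"
      using \<beta>(1)[of x] e by (auto simp: A_def)
    then show "x \<in> S" using S(1) by (simp add: frontier_def interior_open)
  qed
  have "compact ((\<lambda>v. G (Complex (v $ 1) (v $ 2))) ` A)"
  proof (rule compact_continuous_image[OF _ A])
    show "continuous_on A (\<lambda>v. G (Complex (v $ 1) (v $ 2)))"
    proof (rule continuous_on_compose2[OF contG])
      show "continuous_on A (\<lambda>v::real^2. Complex (v $ 1) (v $ 2))"
        unfolding Complex_eq by (intro continuous_intros)
    qed (use AS in auto)
  qed
  moreover have "(\<lambda>v. G (Complex (v $ 1) (v $ 2))) ` A \<subseteq> ball 0 1"
  proof (rule image_subsetI)
    fix v assume "v \<in> A"
    then have "plane (Complex (v $ 1) (v $ 2)) \<in> S" using AS by auto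
    then show "G (Complex (v $ 1) (v $ 2)) \<in> ball 0 1" using G by blast
  qed
  ultimately obtain \<rho> where \<rho>: "\<rho> < 1" "\<And>v. v \<in> A \<Longrightarrow> norm (G (Complex (v $ 1) (v $ 2))) \<le> \<rho>"
  proof (cases "A = {}")
    case True
    then show ?thesis using that[of 0] by auto
  next
    case False
    assume K: "compact ((\<lambda>v. G (Complex (v $ 1) (v $ 2))) ` A)"
      and sub: "(\<lambda>v. G (Complex (v $ 1) (v $ 2))) ` A \<subseteq> ball 0 1"
    obtain w where "w \<in> (\<lambda>v. G (Complex (v $ 1) (v $ 2))) ` A"
      "\<forall>y\<in>(\<lambda>v. G (Complex (v $ 1) (v $ 2))) ` A. norm y \<le> norm w"
      using continuous_attains_sup[OF K, of norm] False by (auto intro: continuous_intros)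
    then show ?thesis using that[of "norm w"] sub by auto
  qed
  have main: "\<bar>u (plane (\<phi> w))\<bar> \<le> \<beta> + e + B / L * Re (h w)"
    if w: "w \<in> ball 0 1" "\<rho> < norm w" for w
  proof (cases "norm (\<phi> w) > R")
    case True
    then have "B / L * L \<le> B / L * Re (h w)"
      using R w B0 L by (intro mult_left_mono) auto
    then have "B \<le> B / L * Re (h w)" using L by simp
    then show ?thesis using B[of "plane (\<phi> w)"] \<phi>[OF w(1)] \<beta>(2) e by linarith
  next
    case False
    have "plane (\<phi> w) \<notin> A"
    proof
      assume "plane (\<phi> w) \<in> A"
      from \<rho>(2)[OF this] show False using \<phi>[OF w(1)] w(2) by simp
    qed
    moreover have "plane (\<phi> w) \<in> closure S"
      using \<phi>[OF w(1)] closure_subset by blast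
    ultimately have "\<bar>u (plane (\<phi> w))\<bar> < \<beta> + e"
      using False by (auto simp: A_def)
    moreover have "0 \<le> B / L * Re (h w)"
      using B0 L h(2)[OF w(1)] by simp
    ultimately show ?thesis by linarith
  qed
  define r where "r = (max 0 \<rho> + 1) / 2"
  have r: "0 < r" "\<rho> < r" "r < 1" using \<rho>(1) by (auto simp: r_def max_def)
  define T where "T = ln r"
  have T: "T < 0" "exp T = r" using r by (auto simp: T_def)
  have cu: "continuous_on (ball 0 1) (\<lambda>w. u (plane (\<phi> w)))"
    by (rule continuous_on_comp_holomorphic[OF u hol]) (use \<phi> in blast)
  have ch: "continuous_on {s. Re s < 0} (\<lambda>s. Re (h (exp s)))"
    by (rule continuous_on_comp_exp)
      (intro continuous_intros holomorphic_on_imp_continuous_on h(1))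
  have "\<bar>circle_int (\<lambda>s. u (plane (\<phi> (exp s)))) T\<bar> \<le>
      circle_int (\<lambda>s. \<beta> + e + B / L * Re (h (exp s))) T"
  proof (rule circle_int_bound[OF continuous_on_comp_exp[OF cu] _ T(1)])
    show "continuous_on {s. Re s < 0} (\<lambda>s. \<beta> + e + B / L * Re (h (exp s)))"
      by (intro continuous_intros ch)
    show "\<bar>u (plane (\<phi> (exp (Complex T \<theta>))))\<bar> \<le> \<beta> + e + B / L * Re (h (exp (Complex T \<theta>)))" for \<theta>
      by (rule main) (use T r in auto)
  qed
  also have "\<dots> = 2 * pi * (\<beta> + e) + B / L * circle_int (\<lambda>s. Re (h (exp s))) T"
    by (rule circle_int_affine[OF ch T(1)])
  also have "\<dots> = 2 * pi * (\<beta> + e + B / L * Re (h 0))"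
    by (simp add: circle_int_holomorphic[OF h(1) T(1)] algebra_simps)
  also have "\<dots> \<le> 2 * pi * (\<beta> + 2 * e)"
    using BL by simp
  finally show ?thesis using T(1) by blast
qed

section \<open>The inradius and the Green function\<close>

text \<open>Finite measure bounds the radii of balls in \<open>S\<close>, so that the supremum in the definition of the
  inradius is a genuine one.\<close>

lemma radius_le_inradius:
  fixes S :: "'a::euclidean_space set"
  assumes S: "emeasure lborel S < \<infinity>" "S \<in> sets borel" and r: "0 < r" "ball x r \<subseteq> S"
  shows "r \<le> inradius S"
  unfolding inradius_def
proof (rule cSup_upper)
  define M where "M = measure lborel S / measure lborel (ball (0::'a) 1)"
  show "bdd_above {r. 0 < r \<and> (\<exists>x. ball x r \<subseteq> S)}"
  proof (rule bdd_aboveI)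
    fix s assume "s \<in> {r. 0 < r \<and> (\<exists>x. ball x r \<subseteq> S)}"
    then obtain x where s: "0 < s" "ball x s \<subseteq> S" by auto
    have "measure lborel (ball x s) \<le> measure lborel S"
      using S s(2) by (intro measure_mono_fmeasurable) (auto simp: fmeasurable_def)
    then have "s ^ DIM('a) \<le> M"
      using content_ball_pos[of 1 "0::'a"] s(1)
      by (simp add: content_ball_conv_unit_ball[of s x] M_def pos_le_divide_eq)
    then show "s \<le> max 1 M"
      using self_le_power[of s "DIM('a)"] by (cases "s \<le> 1") auto
  qed
qed (use r in auto)

text \<open>Bloch's theorem on the disc of radius \<open>1 / 2\<close> about \<open>v\<close> puts a disc of radius
  \<open>(1 / 2) * \<bar>\<phi>' v\<bar> / 12\<close> into the image, which bounds the derivative by the inradius.\<close>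

lemma norm_diff_le_inradius:
  assumes hol: "\<phi> holomorphic_on ball 0 1" and S: "open S" "emeasure lborel S < \<infinity>"
    and into: "\<And>w. w \<in> ball 0 1 \<Longrightarrow> plane (\<phi> w) \<in> S"
    and w: "norm w \<le> 1 / 2"
  shows "norm (\<phi> w - \<phi> 0) \<le> 24 * inradius S * norm w"
proof -
  have deriv_le: "norm (deriv \<phi> v) \<le> 24 * inradius S" if v: "v \<in> cball 0 (1 / 2)" for v
  proof (cases "deriv \<phi> v = 0")
    case True
    obtain r where r: "r > 0" "ball (plane (\<phi> 0)) r \<subseteq> S"
      using into[of 0] S(1) openE by (metis centre_in_ball zero_less_one)
    then have "0 \<le> inradius S" using radius_le_inradius[OF S(2) _ r] S(1) by auto
    then show ?thesis using True by simp
  next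
    case False
    define r where "r = 1 / 2 * norm (deriv \<phi> v) / 12"
    have sub: "ball v (1 / 2) \<subseteq> ball 0 1"
    proof
      fix y assume "y \<in> ball v (1 / 2)"
      then show "y \<in> ball 0 1"
        using v norm_triangle_ineq2[of y v] by (auto simp: dist_norm norm_minus_commute)
    qed
    obtain b where b: "ball b r \<subseteq> \<phi> ` ball v (1 / 2)"
      by (rule Bloch[of \<phi> v "1 / 2" r]) (use sub in \<open>auto simp: r_def intro: holomorphic_on_subset[OF hol]\<close>)
    have "ball (plane b) r \<subseteq> S"
    proof
      fix y assume y: "y \<in> ball (plane b) r"
      obtain z where z: "y = plane z" by (metis plane_Complex)
      then have "z \<in> \<phi> ` ball v (1 / 2)" using b y by auto
      then show "y \<in> S" using z into sub by auto
    qed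
    moreover have "r > 0" using False by (simp add: r_def)
    ultimately have "r \<le> inradius S"
      using radius_le_inradius[OF S(2)] S(1) by auto
    then show ?thesis by (simp add: r_def)
  qed
  have "norm (\<phi> w - \<phi> 0) \<le> 24 * inradius S * norm (w - 0)"
  proof (rule field_differentiable_bound[where S = "cball 0 (1 / 2)" and f' = "deriv \<phi>"])
    show "(\<phi> has_field_derivative deriv \<phi> v) (at v within cball 0 (1 / 2))"
      if "v \<in> cball 0 (1 / 2)" for v
      by (rule has_field_derivative_at_within, rule holomorphic_derivI[OF hol open_ball]) (use that in auto)
  qed (use w deriv_le in auto)
  then show ?thesis by simp
qed

lemma ln_24_le: "ln (24 :: real) \<le> 5"
proof -
  have "ln (24 :: real) \<le> ln (2 ^ 5)" by (subst ln_le_cancel_iff) auto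
  also have "\<dots> = 5 * ln 2" by (subst ln_realpow) auto
  also have "\<dots> \<le> 5" using ln_2_less_1 by simp
  finally show ?thesis .
qed

text \<open>For \<open>\<bar>w\<bar> \<le> 1 / 2\<close>, the previous distance bound gives \<open>- ln \<bar>w\<bar> \<le> ln 24 + ln (r / \<delta>)\<close> with \<open>\<delta>\<close> the distance
  of the two points; as \<open>ln 24 \<le> 5\<close> and \<open>ln (r / \<delta>)\<close> is half the logarithm in the kernel, the factor
  \<open>6\<close> suffices.\<close>

lemma green_function_le_kernel:
  assumes hol: "\<phi> holomorphic_on ball 0 1" and S: "open S" "emeasure lborel S < \<infinity>"
    and into: "\<And>w. w \<in> ball 0 1 \<Longrightarrow> plane (\<phi> w) \<in> S"
    and inj: "inj_on \<phi> (ball 0 1)"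
    and w: "norm w < 1" "w \<noteq> 0"
  shows "- ln (norm w) \<le>
    6 * max 1 (ln ((inradius S)\<^sup>2 / (norm (plane (\<phi> 0) - plane (\<phi> w)))\<^sup>2))"
proof (cases "norm w \<le> 1 / 2")
  case False
  then have "ln (1 / 2) \<le> ln (norm w)" using w by (subst ln_le_cancel_iff) auto
  then have "- ln (norm w) \<le> 1" using ln_2_less_1 by (simp add: ln_div)
  then show ?thesis by linarith
next
  case True
  define \<delta> where "\<delta> = norm (plane (\<phi> 0) - plane (\<phi> w))"
  let ?r = "inradius S"
  have \<delta>_eq: "\<delta> = norm (\<phi> w - \<phi> 0)"
    by (simp add: \<delta>_def plane_diff[symmetric] norm_minus_commute)
  have "\<phi> w \<noteq> \<phi> 0" using inj w by (auto dest: inj_onD)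
  then have \<delta>: "0 < \<delta>" by (simp add: \<delta>_eq)
  have le: "\<delta> \<le> 24 * ?r * norm w"
    unfolding \<delta>_eq by (rule norm_diff_le_inradius[OF hol S into True])
  then have "0 < 24 * ?r * norm w" using \<delta> by linarith
  then have r: "0 < ?r" using w by (simp add: zero_less_mult_iff)
  have "ln \<delta> \<le> ln (24 * ?r * norm w)"
    using le \<delta> r w by (subst ln_le_cancel_iff) auto
  also have "\<dots> = ln 24 + ln ?r + ln (norm w)"
    using r w by (simp add: ln_mult)
  finally have "- ln (norm w) \<le> 5 + (ln ?r - ln \<delta>)"
    using ln_24_le by linarith
  moreover have "ln (?r\<^sup>2 / \<delta>\<^sup>2) = 2 * (ln ?r - ln \<delta>)"
    using r \<delta> by (simp add: ln_div ln_realpow)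
  ultimately have "2 * - ln (norm w) \<le> 10 + ln (?r\<^sup>2 / \<delta>\<^sup>2)" by argo
  moreover have "ln (?r\<^sup>2 / \<delta>\<^sup>2) \<le> max 1 (ln (?r\<^sup>2 / \<delta>\<^sup>2))" "1 \<le> max 1 (ln (?r\<^sup>2 / \<delta>\<^sup>2))"
    by simp_all
  ultimately show ?thesis unfolding \<delta>_def[symmetric] by argo
qed

section \<open>The estimate\<close>

text \<open>The factor \<open>3 / pi\<close> is the constant \<open>6\<close> of the Green function bound divided by the \<open>2 * pi\<close> by which
  circle integrals differ from means.\<close>

lemma pointwise_estimate:
  fixes u :: "real ^ 2 \<Rightarrow> real"
  assumes S: "open S" "emeasure lborel S < \<infinity>" "simply_connected S" "S \<noteq> UNIV"
    and u: "Ck_on 2 S u" "continuous_on (closure S) u"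
    and B: "\<And>y. y \<in> S \<Longrightarrow> \<bar>u y\<bar> \<le> B"
    and \<beta>: "\<And>y. y \<in> frontier S \<Longrightarrow> \<bar>u y\<bar> \<le> \<beta>" "\<beta> \<ge> 0"
    and x: "x \<in> S"
    and J: "(\<integral>\<^sup>+ y \<in> S. ennreal (max 1 (ln ((inradius S)\<^sup>2 / (norm (x - y))\<^sup>2)) * \<bar>laplacian u y\<bar>) \<partial>lborel)
      = ennreal J" "J \<ge> 0"
  shows "\<bar>u x\<bar> \<le> \<beta> + 3 / pi * J"
proof (rule field_le_epsilon)
  fix e :: real assume e: "e > 0"
  obtain \<phi> G where hol: "\<phi> holomorphic_on ball 0 1" and \<phi>0: "plane (\<phi> 0) = x"
    and \<phi>: "\<And>w. w \<in> ball 0 1 \<Longrightarrow> plane (\<phi> w) \<in> S \<and> G (\<phi> w) = w"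
    and contG: "continuous_on {z. plane z \<in> S} G"
    and G: "\<And>z. plane z \<in> S \<Longrightarrow> G z \<in> ball 0 1 \<and> \<phi> (G z) = z"
  proof (rule riemann_map_plane[OF S(1,3,4) x], goal_cases)
    case (1 \<phi> G)
    show thesis by (rule that) (fact 1)+
  qed
  have into: "plane (\<phi> w) \<in> S" if "w \<in> ball 0 1" for w
    using \<phi> that by blast
  have inj: "inj_on \<phi> (ball 0 1)" by (metis \<phi> inj_onI)
  define \<Psi> where "\<Psi> = (\<lambda>s. \<phi> (exp s))"
  let ?H = "{s. Re s < 0}"
  have H: "open ?H" by (rule open_halfspace_Re_lt)
  have expH: "exp s \<in> ball 0 1" if "Re s < 0" for s :: complex
    using that by simp
  have hol\<Psi>: "\<Psi> holomorphic_on ?H"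
  proof -
    have "exp ` ?H \<subseteq> ball 0 1" using expH by blast
    from holomorphic_on_compose_gen[OF holomorphic_on_exp hol this] show ?thesis
      by (simp add: \<Psi>_def o_def)
  qed
  have into\<Psi>: "plane (\<Psi> s) \<in> S" if "Re s < 0" for s
    unfolding \<Psi>_def by (rule into[OF expH[OF that]])
  have per: "\<Psi> (s + 2 * pi * \<i>) = \<Psi> s" for s
    by (simp add: \<Psi>_def exp_add)
  have inj\<Psi>: "inj_on \<Psi> {s. Re s < 0 \<and> 0 < Im s \<and> Im s < 2 * pi}"
  proof (rule inj_onI)
    fix s s' :: complex assume s: "s \<in> {s. Re s < 0 \<and> 0 < Im s \<and> Im s < 2 * pi}"
      "s' \<in> {s. Re s < 0 \<and> 0 < Im s \<and> Im s < 2 * pi}" and eq: "\<Psi> s = \<Psi> s'"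
    have "exp s = exp s'"
    proof (rule inj_onD[OF inj])
      show "\<phi> (exp s) = \<phi> (exp s')" using eq unfolding \<Psi>_def .
    qed (use s expH in blast)+
    moreover have "\<bar>Im s - Im s'\<bar> < 2 * pi" using s by auto
    ultimately show "s = s'" by (rule exp_complex_eqI[rotated])
  qed
  define K where "K = (\<lambda>y. max 1 (ln ((inradius S)\<^sup>2 / (norm (x - y))\<^sup>2)))"
  have K: "K \<in> borel_measurable borel" unfolding K_def by measurable
  have K_ge: "- Re s \<le> 6 * K (plane (\<Psi> s))" if "Re s < 0" for s
    using green_function_le_kernel[OF hol S(1,2) into inj, of "exp s"] that
    by (simp add: K_def \<Psi>_def \<phi>0)
  define V where "V = (\<lambda>s. u (plane (\<Psi> s)))"
  have memH: "\<And>s. s \<in> ?H \<Longrightarrow> plane (\<Psi> s) \<in> S" using into\<Psi> by simp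
  have cV: "continuous_on ?H V"
    unfolding V_def
    by (rule continuous_on_comp_holomorphic[OF u(2) hol\<Psi> memH])
  have c1: "continuous_on ?H (dir_deriv u \<Psi> 1)" and c2: "continuous_on ?H (dir_deriv2 u \<Psi> 1)"
    by (rule continuous_on_dir_deriv[OF u(1) H hol\<Psi> memH], assumption)
      (rule continuous_on_dir_deriv2[OF u(1) H hol\<Psi> memH], assumption)
  have lap: "continuous_on S (laplacian u)"
  proof -
    have "continuous_on S (partial_deriv i (partial_deriv i u))" for i
      using u(1) by (auto simp: numeral_2_eq_2)
    then show ?thesis
      unfolding laplacian_def[abs_def] by (intro continuous_on_sum)
  qed
  obtain T where T: "T < 0" and bT: "\<bar>circle_int V T\<bar> \<le> 2 * pi * (\<beta> + 2 * (e / 2))"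
  proof -
    have "\<exists>T<0. \<bar>circle_int (\<lambda>s. u (plane (\<phi> (exp s)))) T\<bar> \<le> 2 * pi * (\<beta> + 2 * (e / 2))"
      using e by (intro circle_int_near_boundary[where G = G, OF S(1,4) hol \<phi> contG G u(2) B \<beta>]) auto
    then show thesis
      using that unfolding V_def \<Psi>_def by blast
  qed
  have "\<bar>circle_int V T - 2 * pi * u x\<bar> \<le> 6 * J"
  proof (rule taylor_at_bot_bound[where m = "circle_int V" and m' = "circle_int (dir_deriv u \<Psi> 1)"
        and m'' = "circle_int (dir_deriv2 u \<Psi> 1)"])
    show "(circle_int V has_real_derivative circle_int (dir_deriv u \<Psi> 1) t) (at t)" if "t < 0" for t
    proof (rule DERIV_circle_int[OF cV c1 _ that])
      show "((\<lambda>t. V (Complex t \<theta>)) has_real_derivative dir_deriv u \<Psi> 1 (Complex t \<theta>)) (at t)"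
        if "t < 0" for t \<theta>
        unfolding V_def
        by (rule DERIV_pullback[OF u(1) S(1) H hol\<Psi> memH has_vector_derivative_Complex_Re])
          (use that in auto)
    qed
    show "(circle_int (dir_deriv u \<Psi> 1) has_real_derivative circle_int (dir_deriv2 u \<Psi> 1) t) (at t)" if "t < 0" for t
    proof (rule DERIV_circle_int[OF c1 c2 _ that])
      show "((\<lambda>t. dir_deriv u \<Psi> 1 (Complex t \<theta>)) has_real_derivative dir_deriv2 u \<Psi> 1 (Complex t \<theta>)) (at t)"
        if "t < 0" for t \<theta>
        by (rule DERIV_dir_deriv2[OF u(1) S(1) H hol\<Psi> memH has_vector_derivative_Complex_Re])
          (use that in auto)
    qed
    have "continuous_on (ball 0 1) (\<lambda>w. u (plane (\<phi> w)))"
      by (rule continuous_on_comp_holomorphic[OF u(2) hol into])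
    from circle_int_tendsto[OF this]
    show "(circle_int V \<longlongrightarrow> 2 * pi * u x) at_bot"
      by (simp add: V_def \<Psi>_def \<phi>0)
    show "\<bar>integral {A..T} (\<lambda>t. (T - t) * circle_int (dir_deriv2 u \<Psi> 1) t)\<bar> \<le> 6 * J" if "A < T" for A
    proof -
      have "integral {A..T} (\<lambda>t. (T - t) * circle_int (dir_deriv2 u \<Psi> 1) t) =
          integral {A..T} (\<lambda>t. (T - t) *
            circle_int (\<lambda>s. laplacian u (plane (\<Psi> s)) * (cmod (deriv \<Psi> s))\<^sup>2) t)"
        by (rule integral_cong) (use T circle_int_dir_deriv2[OF u(1) S(1) hol\<Psi> into\<Psi> per] in auto)
      then have "ennreal \<bar>integral {A..T} (\<lambda>t. (T - t) * circle_int (dir_deriv2 u \<Psi> 1) t)\<bar> \<le>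
          ennreal 6 * (\<integral>\<^sup>+y\<in>S. ennreal (K y * \<bar>laplacian u y\<bar>) \<partial>lborel)"
        using strip_integral_le[OF hol\<Psi> inj\<Psi> into\<Psi> S(1) lap K K_ge _ T, of A] that by simp
      also have "\<dots> = ennreal (6 * J)"
        using J by (simp add: K_def ennreal_mult)
      finally show ?thesis using J(2) by (subst (asm) ennreal_le_iff) auto
    qed
  qed (rule T)
  then have "2 * pi * \<bar>u x\<bar> \<le> 2 * pi * (\<beta> + e) + 6 * J"
    using bT abs_triangle_ineq4[of "circle_int V T" "circle_int V T - 2 * pi * u x"]
    by (simp add: abs_mult)
  also have "\<dots> = 2 * pi * (\<beta> + 3 / pi * J + e)"
    by (simp add: field_simps)
  finally show "\<bar>u x\<bar> \<le> \<beta> + 3 / pi * J + e"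
    by simp
qed

theorem mainTheorem2:
  "\<exists>c>0. \<forall>(\<Omega> :: (real ^ 2) set) (u :: real ^ 2 \<Rightarrow> real).
     open \<Omega> \<longrightarrow> emeasure lborel \<Omega> < \<infinity> \<longrightarrow> simply_connected \<Omega> \<longrightarrow>
     Ck_on 2 \<Omega> u \<longrightarrow> continuous_on (closure \<Omega>) u \<longrightarrow> bounded (u ` \<Omega>) \<longrightarrow>
     (SUP x\<in>\<Omega>. ennreal \<bar>u x\<bar>)
       \<le> (SUP x\<in>frontier \<Omega>. ennreal \<bar>u x\<bar>)
         + ennreal c *
           (SUP x\<in>\<Omega>. \<integral>\<^sup>+ y \<in> \<Omega>.
              ennreal (max 1 (ln ((inradius \<Omega>)\<^sup>2 / (norm (x - y))\<^sup>2)) * \<bar>laplacian u y\<bar>) \<partial>lborel)"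
proof (intro exI[of _ "3 / pi"] conjI allI impI)
  show "0 < 3 / pi" by simp
  fix S :: "(real ^ 2) set" and u :: "real ^ 2 \<Rightarrow> real"
  assume S: "open S" "emeasure lborel S < \<infinity>" "simply_connected S"
    and u: "Ck_on 2 S u" "continuous_on (closure S) u" and bdd: "bounded (u ` S)"
  define I where "I = (\<lambda>x. \<integral>\<^sup>+ y \<in> S.
      ennreal (max 1 (ln ((inradius S)\<^sup>2 / (norm (x - y))\<^sup>2)) * \<bar>laplacian u y\<bar>) \<partial>lborel)"
  have nU: "S \<noteq> UNIV" using S(2) by auto
  obtain B where "\<And>y. y \<in> u ` S \<Longrightarrow> norm y \<le> B"
    using bdd unfolding bounded_iff by blast
  then have B: "\<And>x. x \<in> S \<Longrightarrow> \<bar>u x\<bar> \<le> B" by fastforce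
  have "u ` closure S \<subseteq> {- B..B}"
    by (rule image_closure_subset[OF u(2)]) (use B in \<open>auto simp: abs_le_iff minus_le_iff\<close>)
  then have "(SUP x\<in>frontier S. ennreal \<bar>u x\<bar>) \<le> ennreal B"
    by (intro SUP_least ennreal_leI) (force simp: frontier_def abs_le_iff)
  then obtain \<beta> where \<beta>: "\<beta> \<ge> 0" "(SUP x\<in>frontier S. ennreal \<bar>u x\<bar>) = ennreal \<beta>"
    by (metis ennreal_cases ennreal_neq_top top.extremum_unique)
  have \<beta>_ge: "\<bar>u y\<bar> \<le> \<beta>" if "y \<in> frontier S" for y
    using SUP_upper[OF that, of "\<lambda>x. ennreal \<bar>u x\<bar>"] \<beta> by simp
  have *: "ennreal \<bar>u x\<bar> \<le> ennreal \<beta> + ennreal (3 / pi) * I x" if x: "x \<in> S" for x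
  proof (cases "I x")
    case (real J)
    then have "\<bar>u x\<bar> \<le> \<beta> + 3 / pi * J"
      using pointwise_estimate[OF S nU u B \<beta>_ge \<beta>(1) x, of J] by (simp add: I_def)
    then have "ennreal \<bar>u x\<bar> \<le> ennreal (\<beta> + 3 / pi * J)"
      by (rule ennreal_leI)
    also have "\<dots> = ennreal \<beta> + ennreal (3 / pi) * ennreal J"
      using \<beta>(1) real by (simp add: ennreal_plus ennreal_mult[symmetric])
    finally show ?thesis using real by simp
  next
    case top
    then show ?thesis by (simp add: ennreal_mult_top)
  qed
  have "ennreal \<bar>u x\<bar> \<le> ennreal \<beta> + ennreal (3 / pi) * (SUP x\<in>S. I x)" if x: "x \<in> S" for x
    by (rule order_trans[OF *[OF x]]) (intro add_left_mono mult_left_mono SUP_upper x, simp)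
  then show "(SUP x\<in>S. ennreal \<bar>u x\<bar>) \<le> (SUP x\<in>frontier S. ennreal \<bar>u x\<bar>)
         + ennreal (3 / pi) * (SUP x\<in>S. \<integral>\<^sup>+ y \<in> S.
              ennreal (max 1 (ln ((inradius S)\<^sup>2 / (norm (x - y))\<^sup>2)) * \<bar>laplacian u y\<bar>) \<partial>lborel)"
    unfolding \<beta>(2) I_def[symmetric] by (rule SUP_least)
qed

end
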